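(* In event-triggered control with perfect information, the policy profile $(\pi^*,\mu^* )$ given by $$\delta_k^*=\mathbf{1}_{\{\mathrm{VoI}_k\ge 0\}},\qquad \mathrm{VoI}_k=e_k^TA_k^T\Gamma_{k+1}A_ke_k-\theta_k+\varrho_k,$$ and $$u_k^*=-L_k\hat x_k,\qquad L_k=(B_k^TS_{k+1}B_k+R_k)^{-1}B_k^TS_{k+1}A_k,$$ is a Nash equilibrium of the problem of minimizing $\Psi(\pi,\mu)$ over admissible triggering policies $\pi$ and admissible control policies $\mu$. Moreover, the optimal triggering policy is a symmetric threshold policy ($\mathrm{VoI}_k$, and hence $\delta_k^*$, is an even function of $e_k$), and the optimal control policy is a certainty-equivalence policy.
   Context: Process: $x_{k+1}=A_kx_k+B_ku_k+w_k$, $k=0,\dots,N$, $x_k\in\mathbb{R}^n$, $u_k\in\mathbb{R}^m$, $x_0\sim\mathcal N(m_0,M_0)$, $w_k$ i.i.d. $\mathcal N(0,W_k)$, $W_k\succ0$, independent of $x_0$, $(A_k,B_k)$ controllable. Perfect information: the event trigger sees $x_k$ at time $k$ and chooses $\delta_k\in\{0,1\}$; $x_k$ is transmitted to the controller with one-step delay iff $\delta_k=1$. Information sets $\mathcal{I}^e_k=\{x_t:t\le k\}$, $\mathcal{I}^c_k=\{x_t:t<k,\delta_t=1\}$; the information associated with non-transmitted observations is discarded at the controller. Admissible policies: $\pi=\{\delta_k\}$ with $\delta_k$ measurable in $\mathcal{I}^e_k$; $\mu=\{u_k\}$ with $u_k$ measurable in $\mathcal{I}^c_k$. Cost: $\Psi(\pi,\mu)=\mathbb{E}\big[x_{N+1}^TQ_{N+1}x_{N+1}+\sum_{k=0}^N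 x_k^TQ_kx_k+u_k^TR_ku_k+\theta_k\delta_k\big]$ with $Q_k\succeq0$, $R_k\succ0$, $\theta_k=\ell_k\lambda\ge 0$. Riccati equation: $S_{N+1}=Q_{N+1}$, $S_k=Q_k+A_k^TS_{k+1}A_k-\Gamma_k$, $\Gamma_k=A_k^TS_{k+1}B_k(B_k^TS_{k+1}B_k+R_k)^{-1}B_k^TS_{k+1}A_k$ for $k\le N$, and $\Gamma_{N+1}=0$. Controller estimate: $\hat x_0=m_0$, $\hat x_k=A_{k-1}\hat x_{k-1}+B_{k-1}u_{k-1}+\delta_{k-1}A_{k-1}(x_{k-1}-\hat x_{k-1})$ (this equals $\mathbb{E}[x_k\mid\mathcal{I}^c_k]$), and $e_k=x_k-\hat x_k$. Value function: $V^e_{N+1}=0$, $V^e_k=\min_{\delta_k}\mathbb{E}[\theta_k\delta_k+e_{k+1}^T\Gamma_{k+1}e_{k+1}+V^e_{k+1}\mid\mathcal{I}^e_k]$, and $\varrho_k=\mathbb{E}[V^e_{k+1}\mid\mathcal{I}^e_k,\delta_k=0]-\mathbb{E}[V^e_{k+1}\mid\mathcal{I}^e_k,\delta_k=1]$. $\mathrm{VoI}_k$ is called the value of information at time $k$. A profile $(\pi^*,\mu^* )$ is a Nash equilibrium if $\Psi(\pi^*,\mu^* )\le\Psi(\pi,\mu^* )$ for all admissible $\pi$ and $\Psi(\pi^*,\mu^* )\le\Psi(\pi^*,\mu)$ for all admissible $\mu$. *)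

theory Defs
  imports "HOL-Probability.Probability"
begin

definition psd :: "real^'n^'n \<Rightarrow> bool" where
  "psd X \<longleftrightarrow> transpose X = X \<and> (\<forall>x. 0 \<le> x \<bullet> (X *v x))"

definition pd :: "real^'n^'n \<Rightarrow> bool" where
  "pd X \<longleftrightarrow> transpose X = X \<and> (\<forall>x. x \<noteq> 0 \<longrightarrow> 0 < x \<bullet> (X *v x))"

fun matpow :: "real^'n^'n \<Rightarrow> nat \<Rightarrow> real^'n^'n" where
  "matpow A 0 = mat 1"
| "matpow A (Suc i) = A ** matpow A i"

text \<open>Controllability of the pair (A,B): the Krylov matrix [B, AB, ..., A^(n-1) B] has full rank n.\<close>
definition controllable :: "real^'n^'n \<Rightarrow> real^'m^'n \<Rightarrow> bool" where
  "controllable A B \<longleftrightarrow> span {matpow A i *v (B *v v) | i v. i < CARD('n)} = UNIV"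

section \<open>Gaussian random vectors (via the characteristic function; allows singular covariance)\<close>

definition gaussian_rv :: "'a measure \<Rightarrow> ('a \<Rightarrow> real^'n) \<Rightarrow> real^'n \<Rightarrow> real^'n^'n \<Rightarrow> bool" where
  "gaussian_rv M X m C \<longleftrightarrow> X \<in> borel_measurable M \<and>
     (\<forall>t. (\<integral>\<omega>. cis (t \<bullet> X \<omega>) \<partial>M) = cis (t \<bullet> m) * complex_of_real (exp (- (t \<bullet> (C *v t)) / 2)))"

definition gen_alg :: "'a measure \<Rightarrow> 'b measure \<Rightarrow> ('i \<Rightarrow> 'a \<Rightarrow> 'b) \<Rightarrow> 'i set \<Rightarrow> 'a measure" where
  "gen_alg M N X I = vimage_algebra (space M) (\<lambda>\<omega>. \<lambda>i\<in>I. X i \<omega>) (Pi\<^sub>M I (\<lambda>_. N))"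

definition obs :: "(nat \<Rightarrow> 'a \<Rightarrow> real^'n) \<Rightarrow> (nat \<Rightarrow> 'a \<Rightarrow> bool) \<Rightarrow> nat \<Rightarrow> 'a \<Rightarrow> bool \<times> (real^'n)" where
  "obs x \<delta> t \<omega> = (\<delta> t \<omega>, if \<delta> t \<omega> then x t \<omega> else 0)"

definition info_e :: "'a measure \<Rightarrow> (nat \<Rightarrow> 'a \<Rightarrow> real^'n) \<Rightarrow> nat \<Rightarrow> 'a measure" where
  "info_e M x k = gen_alg M borel x {..k}"

definition info_c :: "'a measure \<Rightarrow> (nat \<Rightarrow> 'a \<Rightarrow> real^'n) \<Rightarrow> (nat \<Rightarrow> 'a \<Rightarrow> bool) \<Rightarrow> nat \<Rightarrow> 'a measure" where
  "info_c M x \<delta> k = gen_alg M (count_space UNIV \<Otimes>\<^sub>M borel) (obs x \<delta>) {..<k}"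

primrec xhat :: "(nat \<Rightarrow> real^'n^'n) \<Rightarrow> (nat \<Rightarrow> real^'m^'n) \<Rightarrow> real^'n \<Rightarrow> (nat \<Rightarrow> 'a \<Rightarrow> real^'n)
    \<Rightarrow> (nat \<Rightarrow> 'a \<Rightarrow> bool) \<Rightarrow> (nat \<Rightarrow> 'a \<Rightarrow> real^'m) \<Rightarrow> nat \<Rightarrow> 'a \<Rightarrow> real^'n" where
  "xhat A B m0 x \<delta> u 0 = (\<lambda>\<omega>. m0)"
| "xhat A B m0 x \<delta> u (Suc k) = (\<lambda>\<omega>. A k *v xhat A B m0 x \<delta> u k \<omega> + B k *v u k \<omega>
      + (if \<delta> k \<omega> then A k *v (x k \<omega> - xhat A B m0 x \<delta> u k \<omega>) else 0))"

definition realization :: "'a measure \<Rightarrow> (nat \<Rightarrow> real^'n^'n) \<Rightarrow> (nat \<Rightarrow> real^'m^'n) \<Rightarrow> ('a \<Rightarrow> real^'n)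
    \<Rightarrow> (nat \<Rightarrow> 'a \<Rightarrow> real^'n) \<Rightarrow> nat \<Rightarrow> (nat \<Rightarrow> 'a \<Rightarrow> real^'n) \<Rightarrow> (nat \<Rightarrow> 'a \<Rightarrow> bool) \<Rightarrow> (nat \<Rightarrow> 'a \<Rightarrow> real^'m) \<Rightarrow> bool" where
  "realization M A B x0 w N x \<delta> u \<longleftrightarrow>
     (\<forall>\<omega>\<in>space M. x 0 \<omega> = x0 \<omega>) \<and>
     (\<forall>k\<le>N. \<forall>\<omega>\<in>space M. x (Suc k) \<omega> = A k *v x k \<omega> + B k *v u k \<omega> + w k \<omega>) \<and>
     (\<forall>k\<le>N. \<delta> k \<in> measurable (info_e M x k) (count_space UNIV)) \<and>
     (\<forall>k\<le>N. u k \<in> measurable (info_c M x \<delta> k) borel)"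

text \<open>The cost \<Psi> (integrand is nonnegative; nonnegative integral, may be infinite).\<close>
definition cost :: "'a measure \<Rightarrow> (nat \<Rightarrow> real^'n^'n) \<Rightarrow> (nat \<Rightarrow> real^'m^'m) \<Rightarrow> (nat \<Rightarrow> real) \<Rightarrow> nat
    \<Rightarrow> (nat \<Rightarrow> 'a \<Rightarrow> real^'n) \<Rightarrow> (nat \<Rightarrow> 'a \<Rightarrow> bool) \<Rightarrow> (nat \<Rightarrow> 'a \<Rightarrow> real^'m) \<Rightarrow> ennreal" where
  "cost M Q R \<theta> N x \<delta> u = (\<integral>\<^sup>+\<omega>. ennreal (x (Suc N) \<omega> \<bullet> (Q (Suc N) *v x (Suc N) \<omega>)
      + (\<Sum>k\<le>N. x k \<omega> \<bullet> (Q k *v x k \<omega>) + u k \<omega> \<bullet> (R k *v u k \<omega>) + \<theta> k * (if \<delta> k \<omega> then 1 else 0))) \<partial>M)"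

text \<open>Vaux j = V^e_{N+1-j}, as a function of the estimation error e_{N+1-j}.
  Conditional expectations given I^e_k are expectations over the noise w_k (independent of I^e_k),
  since e_{k+1} = (1-\<delta>_k) A_k e_k + w_k.\<close>
primrec Vaux :: "'a measure \<Rightarrow> (nat \<Rightarrow> 'a \<Rightarrow> real^'n) \<Rightarrow> (nat \<Rightarrow> real^'n^'n) \<Rightarrow> (nat \<Rightarrow> real^'n^'n)
    \<Rightarrow> (nat \<Rightarrow> real) \<Rightarrow> nat \<Rightarrow> nat \<Rightarrow> real^'n \<Rightarrow> real" where
  "Vaux M w A \<Gamma> \<theta> N 0 = (\<lambda>e. 0)"
| "Vaux M w A \<Gamma> \<theta> N (Suc j) =
     (let k = N - j;
          c = (\<lambda>z. z \<bullet> (\<Gamma> (Suc k) *v z) + Vaux M w A \<Gamma> \<theta> N j z)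
      in (\<lambda>e. min (\<integral>\<omega>. c (A k *v e + w k \<omega>) \<partial>M) (\<theta> k + (\<integral>\<omega>. c (w k \<omega>) \<partial>M))))"

definition Ve :: "'a measure \<Rightarrow> (nat \<Rightarrow> 'a \<Rightarrow> real^'n) \<Rightarrow> (nat \<Rightarrow> real^'n^'n) \<Rightarrow> (nat \<Rightarrow> real^'n^'n)
    \<Rightarrow> (nat \<Rightarrow> real) \<Rightarrow> nat \<Rightarrow> nat \<Rightarrow> real^'n \<Rightarrow> real" where
  "Ve M w A \<Gamma> \<theta> N k = Vaux M w A \<Gamma> \<theta> N (N + 1 - k)"

text \<open>\<rho>_k = E[V_{k+1} | \<delta>_k = 0] - E[V_{k+1} | \<delta>_k = 1], as a function of e_k.\<close>
definition rho :: "'a measure \<Rightarrow> (nat \<Rightarrow> 'a \<Rightarrow> real^'n) \<Rightarrow> (nat \<Rightarrow> real^'n^'n) \<Rightarrow> (nat \<Rightarrow> real^'n^'n)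
    \<Rightarrow> (nat \<Rightarrow> real) \<Rightarrow> nat \<Rightarrow> nat \<Rightarrow> real^'n \<Rightarrow> real" where
  "rho M w A \<Gamma> \<theta> N k e = (\<integral>\<omega>. Ve M w A \<Gamma> \<theta> N (Suc k) (A k *v e + w k \<omega>) \<partial>M)
                          - (\<integral>\<omega>. Ve M w A \<Gamma> \<theta> N (Suc k) (w k \<omega>) \<partial>M)"

definition VoI :: "'a measure \<Rightarrow> (nat \<Rightarrow> 'a \<Rightarrow> real^'n) \<Rightarrow> (nat \<Rightarrow> real^'n^'n) \<Rightarrow> (nat \<Rightarrow> real^'n^'n)
    \<Rightarrow> (nat \<Rightarrow> real) \<Rightarrow> nat \<Rightarrow> nat \<Rightarrow> real^'n \<Rightarrow> real" where
  "VoI M w A \<Gamma> \<theta> N k e = e \<bullet> ((transpose (A k) ** \<Gamma> (Suc k) ** A k) *v e) - \<theta> k + rho M w A \<Gamma> \<theta> N k e"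

definition trigger_rule :: "'a measure \<Rightarrow> (nat \<Rightarrow> real^'n^'n) \<Rightarrow> (nat \<Rightarrow> real^'m^'n) \<Rightarrow> real^'n
    \<Rightarrow> (nat \<Rightarrow> 'a \<Rightarrow> real^'n) \<Rightarrow> (nat \<Rightarrow> real^'n^'n) \<Rightarrow> (nat \<Rightarrow> real) \<Rightarrow> nat
    \<Rightarrow> (nat \<Rightarrow> 'a \<Rightarrow> real^'n) \<Rightarrow> (nat \<Rightarrow> 'a \<Rightarrow> bool) \<Rightarrow> (nat \<Rightarrow> 'a \<Rightarrow> real^'m) \<Rightarrow> bool" where
  "trigger_rule M A B m0 w \<Gamma> \<theta> N x \<delta> u \<longleftrightarrow>
     (\<forall>k\<le>N. \<forall>\<omega>\<in>space M. \<delta> k \<omega> = (0 \<le> VoI M w A \<Gamma> \<theta> N k (x k \<omega> - xhat A B m0 x \<delta> u k \<omega>)))"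

definition control_rule :: "'a measure \<Rightarrow> (nat \<Rightarrow> real^'n^'n) \<Rightarrow> (nat \<Rightarrow> real^'m^'n) \<Rightarrow> real^'n
    \<Rightarrow> (nat \<Rightarrow> real^'n^'m) \<Rightarrow> nat
    \<Rightarrow> (nat \<Rightarrow> 'a \<Rightarrow> real^'n) \<Rightarrow> (nat \<Rightarrow> 'a \<Rightarrow> bool) \<Rightarrow> (nat \<Rightarrow> 'a \<Rightarrow> real^'m) \<Rightarrow> bool" where
  "control_rule M A B m0 L N x \<delta> u \<longleftrightarrow>
     (\<forall>k\<le>N. \<forall>\<omega>\<in>space M. u k \<omega> = - (L k *v xhat A B m0 x \<delta> u k \<omega>))"

end

theory Submission
  imports Defs
begin

text \<open>The estimation error obeys \<open>e (k+1) = (if \<delta> k then 0 else A k e k) + w k\<close> whatever the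
  controls are. Completing squares along the Riccati recursion turns the cost of any square
  integrable pair of policies into a policy-independent constant plus the expectation of
  \<open>\<Sum>k. (u k + L k x k)\<^sup>T \<Lambda> k (u k + L k x k) + \<theta> k \<delta> k\<close>, where
  \<open>\<Lambda> k = B k\<^sup>T S (k+1) B k + R k\<close>.

  Against the certainty-equivalent controller \<open>u k + L k x k = L k e k\<close>, so the trigger faces a
  dynamic programme in \<open>e\<close> alone, which the value function solves.

  Against the VoI trigger the sequences \<open>e\<close> and \<open>\<delta>\<close> do not depend on the controls at all. Since
  VoI is even and the noise is symmetric, the law of \<open>e k\<close> given the controller's information is
  symmetric, hence centred; so \<open>u k + L k x k = (u k + L k xhat k) + L k e k\<close> is an orthogonal
  decomposition, and the first summand is best set to zero.

  Symmetry of a Gaussian vector, given by its characteristic function, rests on the uniqueness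
  theorem for characteristic functions in several dimensions.\<close>

section \<open>Characteristic functions and Gaussian vectors\<close>

text \<open>The delicate point is that silence is informative: the controller's sigma-algebra is
  generated by the trigger flags as well as by the transmitted states, so under an arbitrary trigger
  \<open>xhat\<close> need not be a conditional mean. The trigger's side of the equilibrium never
  asks for this, since \<open>u + L x = L e\<close> is an algebraic identity for the
  certainty-equivalent controller. The controller's side asks for it only under the VoI trigger,
  where evenness of VoI supplies it. Two further obstacles shape the proof. Policies feed back on
  each other, so independence of \<open>w k\<close> from the past is expressed through exogenous
  sigma-algebras \<open>F k\<close>, generated by \<open>x0\<close> and the earlier noise;
  conditional expectations in the dynamic programme then become Fubini integrals over
  \<open>w k\<close>. Also, a competing control policy may fail to be square integrable; positive
  definiteness of \<open>R\<close> makes its cost infinite in that case, so the cost has to be split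
  only for competitors of finite cost.\<close>

lemma char_cis: "char M t = (\<integral>x. cis (t * x) \<partial>M)"
  by (simp add: char_def cis_conv_exp)

lemma borel_measurable_cis [measurable]: "cis \<in> borel_measurable borel"
  by (intro borel_measurable_continuous_onI continuous_on_cis continuous_on_id)

lemma borel_measurable_vec_nth [measurable (raw)]:
  fixes f :: "'a \<Rightarrow> real^'n"
  shows "f \<in> borel_measurable M \<Longrightarrow> (\<lambda>x. f x $ i) \<in> borel_measurable M"
  by (rule measurable_compose[OF _ borel_measurable_continuous_onI]) (auto intro: continuous_intros)

text \<open>Levy uniqueness speaks of probability distributions. The total mass is the
  characteristic function at 0, so both measures can be divided by the same number; mass zero is
  treated separately. Finite measures are needed because the weighted marginals in the multivariate
  theorem are not normalised.\<close>

lemma finite_borel_measure_eqI_char: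
  fixes \<mu> \<nu> :: "real measure"
  assumes "finite_borel_measure \<mu>" "finite_borel_measure \<nu>"
    and char_eq: "\<And>t. char \<mu> t = char \<nu> t"
  shows "\<mu> = \<nu>"
proof -
  interpret \<mu>: finite_borel_measure \<mu> by fact
  interpret \<nu>: finite_borel_measure \<nu> by fact
  have [measurable_cong, simp]: "sets \<mu> = sets borel" "sets \<nu> = sets borel"
    by (simp_all add: \<mu>.M_is_borel \<nu>.M_is_borel)
  have sp [simp]: "space \<mu> = UNIV" "space \<nu> = UNIV"
    using sets_eq_imp_space_eq[of \<mu> borel] sets_eq_imp_space_eq[of \<nu> borel] by auto
  have mass: "measure \<mu> UNIV = measure \<nu> UNIV"
    using char_eq[of 0] by (simp add: char_cis)
  show ?thesis
  proof (cases "measure \<mu> UNIV = 0")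
    case True
    then have "emeasure \<mu> UNIV = 0" "emeasure \<nu> UNIV = 0"
      using mass by (simp_all add: \<mu>.emeasure_eq_measure \<nu>.emeasure_eq_measure)
    then show ?thesis
      by (intro measure_eqI) (simp_all add: emeasure_eq_0[where N=UNIV])
  next
    case False
    define m where "m = measure \<mu> UNIV"
    have "m > 0" using False measure_nonneg[of \<mu> UNIV] unfolding m_def by linarith
    have norm: "real_distribution (density M (\<lambda>_. ennreal (1 / m)))"
      if "finite_borel_measure M" "measure M UNIV = m" for M :: "real measure"
    proof -
      interpret finite_borel_measure M by fact
      have [simp]: "sets M = sets borel" by (rule M_is_borel)
      have [simp]: "space M = UNIV" using sets_eq_imp_space_eq[of M borel] by auto
      have "emeasure (density M (\<lambda>_. ennreal (1 / m))) UNIV = ennreal (1 / m) * ennreal m"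
        using that by (subst emeasure_density_const) (auto simp: emeasure_eq_measure)
      also have "\<dots> = 1" using \<open>m > 0\<close> by (simp flip: ennreal_mult)
      finally have "prob_space (density M (\<lambda>_. ennreal (1 / m)))"
        by (intro prob_spaceI) simp
      then show ?thesis
        by (auto simp: real_distribution_def real_distribution_axioms_def)
    qed
    have "char (density \<mu> (\<lambda>_. ennreal (1 / m))) = char (density \<nu> (\<lambda>_. ennreal (1 / m)))"
    proof
      fix t
      have "char (density M (\<lambda>_. ennreal (1 / m))) t = (1 / m) *\<^sub>R char M t"
        if [measurable_cong]: "sets M = sets borel" for M :: "real measure"
        using \<open>m > 0\<close> unfolding char_def by (subst integral_density) auto
      then show "char (density \<mu> (\<lambda>_. ennreal (1 / m))) t = char (density \<nu> (\<lambda>_. ennreal (1 / m))) t"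
        by (simp add: char_eq)
    qed
    then have eq: "density \<mu> (\<lambda>_. ennreal (1 / m)) = density \<nu> (\<lambda>_. ennreal (1 / m))"
      using mass by (intro Levy_uniqueness norm) (auto simp: assms m_def)
    have "density (density M (\<lambda>_. ennreal (1 / m))) (\<lambda>_. ennreal m) = M" for M :: "real measure"
    proof -
      have "ennreal (1 / m) * ennreal m = 1"
        using \<open>m > 0\<close> by (simp flip: ennreal_mult)
      then show ?thesis by (simp add: density_density_eq density_1)
    qed
    from this[of \<mu>] this[of \<nu>] show ?thesis unfolding eq by (rule trans[OF sym])
  qed
qed

text \<open>The inner claim \<open>cylinders\<close> interpolates between hypothesis and conclusion:
  it integrates an indicator in the coordinates from \<open>J\<close> times an exponential in all
  coordinates. \<open>J = {}\<close> is the hypothesis; \<open>J = UNIV\<close> with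
  \<open>s = 0\<close> gives equal masses of the orthants \<open>{..a}\<close>, an
  intersection-stable generator of the Borel sets.\<close>

lemma prob_measure_eqI_char:
  fixes \<mu> \<nu> :: "(real^'n) measure"
  assumes "prob_space \<mu>" "prob_space \<nu>"
    and sets [measurable_cong, simp]: "sets \<mu> = sets borel" "sets \<nu> = sets borel"
    and char_eq: "\<And>t. (\<integral>x. cis (t \<bullet> x) \<partial>\<mu>) = (\<integral>x. cis (t \<bullet> x) \<partial>\<nu>)"
  shows "\<mu> = \<nu>"
proof -
  interpret \<mu>: prob_space \<mu> by fact
  interpret \<nu>: prob_space \<nu> by fact
  have sp [simp]: "space \<mu> = UNIV" "space \<nu> = UNIV"
    using sets_eq_imp_space_eq[of \<mu> borel] sets_eq_imp_space_eq[of \<nu> borel] by auto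
  have cyl: "{x::real^'n. \<forall>j\<in>J. x $ j \<in> D j} \<in> sets borel"
    if "\<And>j. D j \<in> sets borel" for D J
  proof -
    have "{x::real^'n. \<forall>j\<in>J. x $ j \<in> D j} = (\<Inter>j\<in>J. (\<lambda>x. x $ j) -` D j \<inter> space borel) \<inter> space borel"
      by auto
    also have "\<dots> \<in> sets borel"
    proof (cases "J = {}")
      case False
      have "(\<lambda>x::real^'n. x $ j) -` D j \<inter> space borel \<in> sets borel" for j
        using that by (intro measurable_sets[where A=borel]) auto
      then show ?thesis using False by (intro sets.Int sets.finite_INT) auto
    qed simp
    finally show ?thesis .
  qed
  have intgb: "integrable M (\<lambda>x. indicator E x *\<^sub>R cis (s \<bullet> x))"
    if "prob_space M" "sets M = sets borel" "E \<in> sets borel" for M E and s :: "real^'n"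
  proof -
    interpret prob_space M by fact
    have [measurable_cong]: "sets M = sets borel" by fact
    show ?thesis using that
      by (intro integrable_const_bound[where B=1]) (auto simp: indicator_def)
  qed
  (* Indicators replace exponentials one coordinate at a time: the weight 1 + cos (s \<bullet> x + a)
     is nonnegative, so Levy's one-dimensional theorem applies to the weighted marginal. *)
  have cylinders: "(\<integral>x. indicator {x. \<forall>j\<in>J. x $ j \<in> D j} x *\<^sub>R cis (s \<bullet> x) \<partial>\<mu>)
                 = (\<integral>x. indicator {x. \<forall>j\<in>J. x $ j \<in> D j} x *\<^sub>R cis (s \<bullet> x) \<partial>\<nu>)"
    if "finite J" and D: "\<And>j. D j \<in> sets borel" for J D s
    using \<open>finite J\<close>
  proof (induction J arbitrary: s)
    case empty
    then show ?case by (simp add: char_eq)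
  next
    case (insert i J)
    define E where "E = {x::real^'n. \<forall>j\<in>J. x $ j \<in> D j}"
    have [measurable]: "E \<in> sets borel" unfolding E_def using D by (rule cyl)
    have [measurable]: "D i \<in> sets borel" by (rule D)
    define p where "p s a x = indicator E x * (1 + cos (s \<bullet> x + a))" for s x :: "real^'n" and a :: real
    have p_nonneg: "0 \<le> p s a x" for s a x
    proof -
      have "0 \<le> 1 + cos (s \<bullet> x + a)" using cos_ge_minus_one[of "s \<bullet> x + a"] by linarith
      then show ?thesis by (simp add: p_def)
    qed
    have p_le: "p s a x \<le> 2" for s a x
      unfolding p_def using cos_le_one[of "s \<bullet> x + a"] by (auto simp: indicator_def)
    have [measurable]: "p s a \<in> borel_measurable borel" for s a
      unfolding p_def by measurable
    define marg where "marg M s a = distr (density M (\<lambda>x. ennreal (p s a x))) borel (\<lambda>x. x $ i)" for M s a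
    have fin: "finite_borel_measure (marg M s a)"
      if "prob_space M" and [measurable_cong]: "sets M = sets borel" for M s a
    proof -
      interpret prob_space M by fact
      have "(\<integral>\<^sup>+x. ennreal (p s a x) \<partial>M) \<le> (\<integral>\<^sup>+x. 2 \<partial>M)"
        using p_le by (intro nn_integral_mono) (simp flip: ennreal_numeral)
      also have "\<dots> < \<infinity>" by (simp add: emeasure_space_1)
      finally have "(\<integral>\<^sup>+x. ennreal (p s a x) \<partial>M) \<noteq> \<infinity>" by simp
      then have "finite_measure (density M (\<lambda>x. ennreal (p s a x)))"
        by (intro finite_measureI) (simp add: emeasure_density cong: nn_integral_cong)
      then have "finite_measure (marg M s a)"
        unfolding marg_def by (rule finite_measure.finite_measure_distr) measurable
      then show ?thesis
        by (simp add: finite_borel_measure_def finite_borel_measure_axioms_def marg_def)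
    qed
    \<comment> \<open>By the product formula for cosines this is a combination of mixed integrals
      with frequencies \<open>t\<close>, \<open>s + t\<close> and \<open>t - s\<close>, where
      \<open>t\<close> points along axis \<open>i\<close>. The induction hypothesis covers all three
      because \<open>s\<close> is kept arbitrary.\<close>
    have char_marg: "char (marg M s a) t
        = (\<integral>x. indicator E x *\<^sub>R cis ((t *\<^sub>R axis i 1) \<bullet> x) \<partial>M)
          + cis a / 2 * (\<integral>x. indicator E x *\<^sub>R cis ((s + t *\<^sub>R axis i 1) \<bullet> x) \<partial>M)
          + cis (- a) / 2 * (\<integral>x. indicator E x *\<^sub>R cis ((t *\<^sub>R axis i 1 - s) \<bullet> x) \<partial>M)"
      if M: "prob_space M" "sets M = sets borel" for M s a t
    proof -
      have [measurable_cong]: "sets M = sets borel" by fact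
      have "char (marg M s a) t = (\<integral>x. p s a x *\<^sub>R cis (t * x $ i) \<partial>M)"
        unfolding char_cis marg_def using p_nonneg
        by (simp add: integral_distr integral_density)
      also have "\<dots> = (\<integral>x. indicator E x *\<^sub>R cis ((t *\<^sub>R axis i 1) \<bullet> x)
          + (cis a / 2 * (indicator E x *\<^sub>R cis ((s + t *\<^sub>R axis i 1) \<bullet> x))
          + cis (- a) / 2 * (indicator E x *\<^sub>R cis ((t *\<^sub>R axis i 1 - s) \<bullet> x))) \<partial>M)"
      proof (intro Bochner_Integration.integral_cong refl)
        fix x
        have c: "complex_of_real (cos (y + a)) * cis z = cis a / 2 * cis (y + z) + cis (- a) / 2 * cis (z - y)"
          for y z :: real
        proof -
          have "complex_of_real (cos v) = (cis v + cis (- v)) / 2" for v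
            by (simp add: complex_eq_iff)
          note this[of "y + a"]
          moreover have "cis a * cis (y + z) = cis (y + a) * cis z"
            "cis (- a) * cis (z - y) = cis (- (y + a)) * cis z"
            by (simp_all add: cis_mult algebra_simps)
          ultimately show ?thesis by (simp add: add_divide_distrib distrib_right)
        qed
        have "p s a x *\<^sub>R cis (t * x $ i) =
           indicator E x *\<^sub>R (cis (t * x $ i) + complex_of_real (cos (s \<bullet> x + a)) * cis (t * x $ i))"
          by (simp add: p_def scaleR_conv_of_real algebra_simps)
        also have "complex_of_real (cos (s \<bullet> x + a)) * cis (t * x $ i) =
            cis a / 2 * cis (s \<bullet> x + t * x $ i) + cis (- a) / 2 * cis (t * x $ i - s \<bullet> x)"
          by (rule c)
        finally show "p s a x *\<^sub>R cis (t * x $ i) = indicator E x *\<^sub>R cis ((t *\<^sub>R axis i 1) \<bullet> x)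
          + (cis a / 2 * (indicator E x *\<^sub>R cis ((s + t *\<^sub>R axis i 1) \<bullet> x))
          + cis (- a) / 2 * (indicator E x *\<^sub>R cis ((t *\<^sub>R axis i 1 - s) \<bullet> x)))"
          by (simp add: inner_axis' inner_add_left inner_diff_left scaleR_add_right)
      qed
      also have "\<dots> = (\<integral>x. indicator E x *\<^sub>R cis ((t *\<^sub>R axis i 1) \<bullet> x) \<partial>M)
          + cis a / 2 * (\<integral>x. indicator E x *\<^sub>R cis ((s + t *\<^sub>R axis i 1) \<bullet> x) \<partial>M)
          + cis (- a) / 2 * (\<integral>x. indicator E x *\<^sub>R cis ((t *\<^sub>R axis i 1 - s) \<bullet> x) \<partial>M)"
        by (simp only: Bochner_Integration.integral_add Bochner_Integration.integrable_add
            intgb[OF M \<open>E \<in> sets borel\<close>] integrable_mult_right integral_mult_right_zero add.assoc)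
      finally show ?thesis .
    qed
    have marg_eq: "marg \<mu> s a = marg \<nu> s a" for s a
      by (intro finite_borel_measure_eqI_char fin assms)
         (simp only: char_marg[OF assms(1,3)] char_marg[OF assms(2,4)] insert.IH[folded E_def])
    have marg_D: "measure (marg M s a) (D i) = (\<integral>x. indicator (E \<inter> {x. x $ i \<in> D i}) x * (1 + cos (s \<bullet> x + a)) \<partial>M)"
      if M: "prob_space M" "sets M = sets borel" for M s a
    proof -
      have [measurable_cong]: "sets M = sets borel" by fact
      interpret m: finite_borel_measure "marg M s a" by (rule fin[OF M])
      have "measure (marg M s a) (D i) = (\<integral>y. indicator (D i) y \<partial>marg M s a)"
        by (simp add: marg_def)
      also have "\<dots> = (\<integral>x. p s a x * indicator (D i) (x $ i) \<partial>M)"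
        unfolding marg_def using p_nonneg by (subst integral_distr, measurable, subst integral_density) auto
      also have "\<dots> = (\<integral>x. indicator (E \<inter> {x. x $ i \<in> D i}) x * (1 + cos (s \<bullet> x + a)) \<partial>M)"
        by (intro Bochner_Integration.integral_cong) (auto simp: p_def indicator_def)
      finally show ?thesis .
    qed
    have w: "(\<integral>x. indicator (E \<inter> {x. x $ i \<in> D i}) x * (1 + cos (s \<bullet> x + a)) \<partial>\<mu>)
        = (\<integral>x. indicator (E \<inter> {x. x $ i \<in> D i}) x * (1 + cos (s \<bullet> x + a)) \<partial>\<nu>)" for s a
      using marg_D[OF assms(1,3), of s a] marg_D[OF assms(2,4), of s a] marg_eq[of s a] by simp
    define G where "G = E \<inter> {x. x $ i \<in> D i}"
    have "G = E \<inter> ((\<lambda>x. x $ i) -` D i \<inter> space borel)" by (auto simp: G_def)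
    then have G [measurable]: "G \<in> sets borel" by simp
    have ic: "integrable M (\<lambda>x. indicator G x * cos (s \<bullet> x + a))" "integrable M (indicator G :: _ \<Rightarrow> real)"
      if "prob_space M" "sets M = sets borel" for M and s :: "real^'n" and a
    proof -
      interpret prob_space M by fact
      have [measurable_cong]: "sets M = sets borel" by fact
      show "integrable M (\<lambda>x. indicator G x * cos (s \<bullet> x + a))" "integrable M (indicator G :: _ \<Rightarrow> real)"
        by (auto intro!: integrable_const_bound[where B=1] simp: indicator_def)
    qed
    \<comment> \<open>At \<open>s = 0\<close>, \<open>a = 0\<close> the weight is the constant 2, so
      \<open>w\<close> already compares the masses of \<open>G\<close>; subtracting them from
      \<open>w\<close> isolates the cosine part.\<close>
    have one: "(\<integral>x. indicator G x \<partial>\<mu>) = ((\<integral>x. indicator G x \<partial>\<nu>) :: real)"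
      using w[of 0 0] unfolding G_def[symmetric] by simp
    have c: "(\<integral>x. indicator G x * cos (s \<bullet> x + a) \<partial>\<mu>) = (\<integral>x. indicator G x * cos (s \<bullet> x + a) \<partial>\<nu>)" for s a
      using w[of s a] one ic assms unfolding G_def[symmetric] by (simp add: distrib_left)
    \<comment> \<open>The phase \<open>a = - pi / 2\<close> turns the cosine into a sine, so the
      real identity \<open>c\<close> yields the real and the imaginary part of the
      exponential.\<close>
    have decomp: "(\<integral>x. indicator G x *\<^sub>R cis (s \<bullet> x) \<partial>M) =
        Complex (\<integral>x. indicator G x * cos (s \<bullet> x) \<partial>M) (\<integral>x. indicator G x * cos (s \<bullet> x - pi / 2) \<partial>M)"
      if "prob_space M" "sets M = sets borel" for M
    proof -
      have sin: "cos (y - pi / 2) = sin y" for y :: real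
        by (simp add: cos_diff)
      have "Re (\<integral>x. indicator G x *\<^sub>R cis (s \<bullet> x) \<partial>M) = (\<integral>x. indicator G x * cos (s \<bullet> x) \<partial>M)"
        "Im (\<integral>x. indicator G x *\<^sub>R cis (s \<bullet> x) \<partial>M) = (\<integral>x. indicator G x * sin (s \<bullet> x) \<partial>M)"
        using intgb[OF that G, of s] by (simp_all flip: integral_Re integral_Im)
      then show ?thesis by (simp add: complex_eq_iff sin)
    qed
    have "{x. \<forall>j\<in>insert i J. x $ j \<in> D j} = G" by (auto simp: G_def E_def)
    then show ?case using decomp[OF assms(1,3)] decomp[OF assms(2,4)] c[of s 0] c[of s "- pi / 2"] by simp
  qed
  have ms: "emeasure \<mu> {..a} = emeasure \<nu> {..a}" for a
  proof -
    have eq: "{..a} = {x. \<forall>j\<in>UNIV. x $ j \<in> {..a $ j}}"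
      by (auto simp: less_eq_vec_def)
    have "complex_of_real (measure \<mu> {..a}) = (\<integral>x. indicator {..a} x *\<^sub>R cis (0 \<bullet> x) \<partial>\<mu>)"
      by (simp add: of_real_def less_top[symmetric])
    also have "\<dots> = (\<integral>x. indicator {..a} x *\<^sub>R cis (0 \<bullet> x) \<partial>\<nu>)"
      unfolding eq by (rule cylinders) auto
    also have "\<dots> = complex_of_real (measure \<nu> {..a})"
      by (simp add: of_real_def less_top[symmetric])
    finally show ?thesis
      by (simp only: \<mu>.emeasure_eq_measure \<nu>.emeasure_eq_measure of_real_eq_iff)
  qed
  show ?thesis
  proof (rule measure_eqI_generator_eq)
    show "Int_stable (range (\<lambda>a::real^'n. {..a}))"
    proof (rule Int_stableI)
      fix X Y assume "X \<in> range (\<lambda>a::real^'n. {..a})" "Y \<in> range (\<lambda>a::real^'n. {..a})"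
      then obtain a b where "X = {..a}" "Y = {..b}" by auto
      then have "X \<inter> Y = {..inf a b}" by auto
      then show "X \<inter> Y \<in> range (\<lambda>a::real^'n. {..a})" by blast
    qed
    show "sets \<mu> = sigma_sets UNIV (range (\<lambda>a::real^'n. {..a}))"
      "sets \<nu> = sigma_sets UNIV (range (\<lambda>a::real^'n. {..a}))"
      unfolding sets by (subst borel_eq_atMost, simp)+
    show "range (\<lambda>k::nat. {..(\<chi> i. real k) :: real^'n}) \<subseteq> range (\<lambda>a. {..a})" by auto
    show "(\<Union>k::nat. {..(\<chi> i. real k) :: real^'n}) = UNIV"
    proof safe
      fix x :: "real^'n"
      obtain k :: nat where "norm x \<le> real k" using real_arch_simple by blast
      then have "x \<le> (\<chi> i. real k)"
        using component_le_norm_cart[of x] by (auto simp: less_eq_vec_def intro: order_trans abs_le_D1)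
      then show "x \<in> (\<Union>k::nat. {..(\<chi> i. real k)})" by auto
    qed simp
  qed (auto simp: ms)
qed

text \<open>Centring removes the phase: the characteristic function of \<open>X - m\<close> is a
  real exponential of a quadratic form, hence even, and its value at \<open>- t\<close> is that of
  the reflected vector at \<open>t\<close>.\<close>

lemma gaussian_rv_symmetric:
  assumes "prob_space M" and X: "gaussian_rv M X m C"
  shows "distr M borel (\<lambda>\<omega>. X \<omega> - m) = distr M borel (\<lambda>\<omega>. - (X \<omega> - m))"
proof -
  interpret prob_space M by fact
  have [measurable]: "X \<in> borel_measurable M" using X by (simp add: gaussian_rv_def)
  have char: "(\<integral>\<omega>. cis (t \<bullet> (X \<omega> - m)) \<partial>M) = complex_of_real (exp (- (t \<bullet> (C *v t)) / 2))" for t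
  proof -
    have "(\<integral>\<omega>. cis (t \<bullet> (X \<omega> - m)) \<partial>M) = (\<integral>\<omega>. cis (- (t \<bullet> m)) * cis (t \<bullet> X \<omega>) \<partial>M)"
      by (simp add: cis_mult inner_diff_right)
    also have "\<dots> = cis (- (t \<bullet> m)) * (cis (t \<bullet> m) * complex_of_real (exp (- (t \<bullet> (C *v t)) / 2)))"
      using X by (simp only: integral_mult_right_zero gaussian_rv_def)
    also have "\<dots> = complex_of_real (exp (- (t \<bullet> (C *v t)) / 2))"
      by (simp only: mult.assoc[symmetric] cis_mult) simp
    finally show ?thesis .
  qed
  show ?thesis
  proof (rule prob_measure_eqI_char)
    fix t
    have "(\<integral>\<omega>. cis (t \<bullet> - (X \<omega> - m)) \<partial>M) = (\<integral>\<omega>. cis ((- t) \<bullet> (X \<omega> - m)) \<partial>M)"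
      by (simp only: inner_minus_left inner_minus_right)
    also have "\<dots> = complex_of_real (exp (- (t \<bullet> (C *v t)) / 2))"
      unfolding char by (simp add: linear_neg[OF matrix_vector_mul_linear])
    finally have "(\<integral>\<omega>. cis (t \<bullet> - (X \<omega> - m)) \<partial>M) = (\<integral>\<omega>. cis (t \<bullet> (X \<omega> - m)) \<partial>M)"
      by (simp only: char)
    then show "(\<integral>x. cis (t \<bullet> x) \<partial>distr M borel (\<lambda>\<omega>. X \<omega> - m)) = (\<integral>x. cis (t \<bullet> x) \<partial>distr M borel (\<lambda>\<omega>. - (X \<omega> - m)))"
      by (subst (1 2) integral_distr) auto
  qed (auto intro!: prob_space_distr)
qed

text \<open>Fatou's lemma for \<open>(1 - cos (s y)) / s\<^sup>2 \<longlonglongrightarrow> y\<^sup>2 / 2\<close> as \<open>s \<longlonglongrightarrow> 0\<close>.\<close>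
lemma (in prob_space) integrable_square_of_cos_bound:
  fixes Y :: "'a \<Rightarrow> real"
  assumes [measurable]: "Y \<in> borel_measurable M"
    and bound: "\<And>s. 1 - (\<integral>\<omega>. cos (s * Y \<omega>) \<partial>M) \<le> c * s\<^sup>2"
  shows "integrable M (\<lambda>\<omega>. (Y \<omega>)\<^sup>2)"
proof -
  define s where "s n = 1 / real (Suc n)" for n
  have s_pos: "s n > 0" for n by (simp add: s_def)
  have s_lim: "s \<longlonglongrightarrow> 0" unfolding s_def by (rule LIMSEQ_inverse_real_of_nat[unfolded inverse_eq_divide])
  define h where "h n \<omega> = (1 - cos (s n * Y \<omega>)) / (s n)\<^sup>2" for n \<omega>
  have h_nonneg: "0 \<le> h n \<omega>" for n \<omega> by (simp add: h_def)
  have [measurable]: "h n \<in> borel_measurable M" for n unfolding h_def by measurable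
  \<comment> \<open>Half-angle form: the quotient is \<open>(Y \<omega>)\<^sup>2 / 2\<close> times
    the square of \<open>sin y / y\<close> at \<open>y = s n * Y \<omega> / 2\<close>, and that
    factor tends to 1.\<close>
  have half: "h n \<omega> = (Y \<omega>)\<^sup>2 / 2 * (if Y \<omega> = 0 then 1 else (sin (s n * Y \<omega> / 2) / (s n * Y \<omega> / 2))\<^sup>2)" for n \<omega>
  proof -
    have "1 - cos (s n * Y \<omega>) = 2 * (sin (s n * Y \<omega> / 2))\<^sup>2"
      using cos_double_sin[of "s n * Y \<omega> / 2"] by simp
    then show ?thesis using s_pos[of n] by (simp add: h_def power_divide power_mult_distrib field_simps)
  qed
  have h_lim: "(\<lambda>n. h n \<omega>) \<longlonglongrightarrow> (Y \<omega>)\<^sup>2 / 2" for \<omega>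
  proof (cases "Y \<omega> = 0")
    case False
    have "filterlim (\<lambda>n. s n * Y \<omega> / 2) (at 0) sequentially"
      unfolding filterlim_at using False s_pos s_lim
      by (auto intro!: tendsto_eq_intros simp: less_imp_neq[symmetric])
    from filterlim_compose[OF _ this, of "\<lambda>x. sin x / x" "nhds 1"]
    have "(\<lambda>n. sin (s n * Y \<omega> / 2) / (s n * Y \<omega> / 2)) \<longlonglongrightarrow> 1"
      by (simp add: sinc_at_0)
    then have "(\<lambda>n. (Y \<omega>)\<^sup>2 / 2 * (sin (s n * Y \<omega> / 2) / (s n * Y \<omega> / 2))\<^sup>2) \<longlonglongrightarrow> (Y \<omega>)\<^sup>2 / 2 * 1\<^sup>2"
      by (intro tendsto_intros)
    then show ?thesis using False by (simp add: half)
  qed (simp add: h_def)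
  have h_int: "(\<integral>\<^sup>+\<omega>. ennreal (h n \<omega>) \<partial>M) \<le> ennreal c" for n
  proof -
    have i: "integrable M (\<lambda>\<omega>. cos (s n * Y \<omega>))"
      by (intro integrable_const_bound[where B=1]) auto
    then have "integrable M (h n)" unfolding h_def by (intro integrable_divide) auto
    then have "(\<integral>\<^sup>+\<omega>. ennreal (h n \<omega>) \<partial>M) = ennreal (\<integral>\<omega>. h n \<omega> \<partial>M)"
      by (intro nn_integral_eq_integral) (auto simp: h_nonneg)
    also have "(\<integral>\<omega>. h n \<omega> \<partial>M) = (1 - (\<integral>\<omega>. cos (s n * Y \<omega>) \<partial>M)) / (s n)\<^sup>2"
      using i by (simp add: h_def prob_space)
    also have "\<dots> \<le> c" using bound[of "s n"] s_pos[of n] by (simp add: divide_le_eq)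
    finally show ?thesis by (simp add: ennreal_leI)
  qed
  have "(\<integral>\<^sup>+\<omega>. ennreal ((Y \<omega>)\<^sup>2 / 2) \<partial>M) = (\<integral>\<^sup>+\<omega>. liminf (\<lambda>n. ennreal (h n \<omega>)) \<partial>M)"
    by (intro nn_integral_cong lim_imp_Liminf[symmetric] tendsto_ennrealI h_lim) simp
  also have "\<dots> \<le> liminf (\<lambda>n. \<integral>\<^sup>+\<omega>. ennreal (h n \<omega>) \<partial>M)"
    by (intro nn_integral_liminf) auto
  also have "\<dots> \<le> ennreal c"
    by (rule Liminf_le) (simp_all add: h_int)
  finally have "(\<integral>\<^sup>+\<omega>. ennreal ((Y \<omega>)\<^sup>2 / 2) \<partial>M) < \<infinity>"
    by (rule order_le_less_trans) simp
  then have "integrable M (\<lambda>\<omega>. (Y \<omega>)\<^sup>2 / 2)"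
    by (intro integrableI_nonneg) auto
  from integrable_mult_right[OF this, of 2] show ?thesis by simp
qed

text \<open>Coordinate \<open>i\<close> of \<open>X - m\<close> has characteristic function
  \<open>exp (- q)\<close> with \<open>q\<close> equal to \<open>s\<^sup>2 / 2\<close> times the
  \<open>i\<close>-th diagonal entry of \<open>C\<close>. The quadratic bound required is
  \<open>1 - exp (- q) \<le> q\<close>, with half that entry as the constant.\<close>

lemma gaussian_rv_integrable_norm_square:
  assumes "prob_space M" and X: "gaussian_rv M X m C"
  shows "integrable M (\<lambda>\<omega>. (norm (X \<omega> - m))\<^sup>2)"
proof -
  interpret prob_space M by fact
  have [measurable]: "X \<in> borel_measurable M" using X by (simp add: gaussian_rv_def)
  have "integrable M (\<lambda>\<omega>. ((X \<omega> - m) $ i)\<^sup>2)" for i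
  proof (rule integrable_square_of_cos_bound)
    fix s :: real
    let ?t = "s *\<^sub>R axis i 1 :: real^'b"
    let ?q = "?t \<bullet> (C *v ?t) / 2"
    have q: "?q = s\<^sup>2 * (axis i 1 \<bullet> (C *v axis i 1)) / 2"
      by (simp add: matrix_vector_mult_scaleR power2_eq_square)
    have int: "integrable M (\<lambda>\<omega>. cis (?t \<bullet> X \<omega>))"
      by (intro integrable_const_bound[where B=1]) auto
    have "(\<integral>\<omega>. cos (s * (X \<omega> - m) $ i) \<partial>M) = (\<integral>\<omega>. Re (cis (- (?t \<bullet> m)) * cis (?t \<bullet> X \<omega>)) \<partial>M)"
      by (simp add: cis_mult inner_axis' algebra_simps)
    also have "\<dots> = Re (cis (- (?t \<bullet> m)) * (\<integral>\<omega>. cis (?t \<bullet> X \<omega>) \<partial>M))"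
      using int by (subst integral_Re) (auto intro!: integrable_mult_right simp del: inner_scaleR_left)
    also have "(\<integral>\<omega>. cis (?t \<bullet> X \<omega>) \<partial>M) = cis (?t \<bullet> m) * complex_of_real (exp (- ?q))"
      using X by (simp only: gaussian_rv_def minus_divide_left)
    also have "Re (cis (- (?t \<bullet> m)) * (cis (?t \<bullet> m) * complex_of_real (exp (- ?q)))) = exp (- ?q)"
      by (simp only: mult.assoc[symmetric] cis_mult) simp
    finally have "1 - (\<integral>\<omega>. cos (s * (X \<omega> - m) $ i) \<partial>M) = 1 - exp (- ?q)" by simp
    also have "\<dots> \<le> ?q" using exp_ge_add_one_self[of "- ?q"] by linarith
    finally show "1 - (\<integral>\<omega>. cos (s * (X \<omega> - m) $ i) \<partial>M) \<le> (axis i 1 \<bullet> (C *v axis i 1)) / 2 * s\<^sup>2"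
      by (simp only: q mult_ac times_divide_eq_left)
  qed measurable
  then have "integrable M (\<lambda>\<omega>. \<Sum>i\<in>UNIV. ((X \<omega> - m) $ i)\<^sup>2)" by (intro Bochner_Integration.integrable_sum)
  then show ?thesis by (simp add: norm_vec_def L2_set_def sum_nonneg)
qed

section \<open>Riccati recursion\<close>

lemma inner_vector_matrix_mult: "x \<bullet> (y v* A) = (A *v x) \<bullet> (y :: real^'m)"
  by (subst (1 2) inner_commute) (rule dot_lmul_matrix)

lemma symmetric_inner_commute:
  assumes "transpose X = X"
  shows "x \<bullet> (X *v y) = y \<bullet> (X *v (x :: real^'n))"
  proof -
  have "x \<bullet> (X *v y) = (transpose X *v x) \<bullet> y" by (simp add: dot_lmul_matrix)
  then show ?thesis by (simp only: assms inner_commute)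
qed

lemma pd_imp_psd: "pd X \<Longrightarrow> psd X"
  unfolding pd_def psd_def by (metis inner_zero_left less_eq_real_def)

lemma pd_invertible:
  assumes "pd X"
  shows "invertible X"
proof -
  have "x = 0" if "X *v x = 0" for x
    using assms that unfolding pd_def by (metis inner_zero_right less_irrefl)
  then show ?thesis
    by (simp add: invertible_left_inverse matrix_left_invertible_ker)
qed

lemma pd_matrix_inv_right:
  assumes "pd X"
  shows "X ** matrix_inv X = mat 1"
  using pd_invertible[OF assms] unfolding invertible_def matrix_inv_def
  by (rule someI2_ex) simp

text \<open>The constant is the minimum of the quadratic form on the compact unit sphere;
  homogeneity extends the bound. It later converts finite cost into square integrability of the
  controls.\<close>

lemma pd_lower_bound:
  fixes X :: "real^'n^'n"
  assumes "pd X"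
  obtains r where "r > 0" "\<And>x. r * (norm x)\<^sup>2 \<le> x \<bullet> (X *v x)"
proof -
  have cont: "continuous_on (sphere 0 1) (\<lambda>x. x \<bullet> (X *v x))"
    by (intro continuous_intros linear_continuous_on matrix_vector_mul_bounded_linear)
  have ne: "sphere (0::real^'n) 1 \<noteq> {}" by simp
  obtain y where y: "y \<in> sphere 0 1" "\<And>x. x \<in> sphere 0 1 \<Longrightarrow> y \<bullet> (X *v y) \<le> x \<bullet> (X *v x)"
    using continuous_attains_inf[OF compact_sphere ne cont] by blast
  have "y \<noteq> 0" using y(1) by auto
  then have "0 < y \<bullet> (X *v y)" using assms by (simp add: pd_def)
  moreover have "y \<bullet> (X *v y) * (norm x)\<^sup>2 \<le> x \<bullet> (X *v x)" for x
  proof (cases "x = 0")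
    case False
    define z where "z = x /\<^sub>R norm x"
    have x: "x = norm x *\<^sub>R z" using False by (simp add: z_def)
    have "y \<bullet> (X *v y) \<le> z \<bullet> (X *v z)" using False by (intro y(2)) (simp add: z_def)
    then have "y \<bullet> (X *v y) * (norm x)\<^sup>2 \<le> z \<bullet> (X *v z) * (norm x)\<^sup>2" by (intro mult_right_mono) auto
    also have "\<dots> = (norm x *\<^sub>R z) \<bullet> (X *v (norm x *\<^sub>R z))"
      by (simp add: matrix_vector_mult_scaleR power2_eq_square)
    finally show ?thesis by (simp only: x[symmetric])
  qed simp
  ultimately show thesis by (rule that)
qed

locale riccati =
  fixes A :: "nat \<Rightarrow> real^'n^'n" and B :: "nat \<Rightarrow> real^'m^'n"
    and Q :: "nat \<Rightarrow> real^'n^'n" and R :: "nat \<Rightarrow> real^'m^'m" and N :: nat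
    and S :: "nat \<Rightarrow> real^'n^'n" and \<Gamma> :: "nat \<Rightarrow> real^'n^'n" and L :: "nat \<Rightarrow> real^'n^'m"
  assumes Q_psd: "k \<le> Suc N \<Longrightarrow> psd (Q k)" and R_pd: "k \<le> N \<Longrightarrow> pd (R k)"
    and S_final: "S (Suc N) = Q (Suc N)"
    and Gamma_eq: "k \<le> N \<Longrightarrow> \<Gamma> k = transpose (A k) ** S (Suc k) ** B k
                     ** matrix_inv (transpose (B k) ** S (Suc k) ** B k + R k)
                     ** transpose (B k) ** S (Suc k) ** A k"
    and S_rec: "k \<le> N \<Longrightarrow> S k = Q k + transpose (A k) ** S (Suc k) ** A k - \<Gamma> k"
    and Gamma_final: "\<Gamma> (Suc N) = 0"
    and L_eq: "k \<le> N \<Longrightarrow> L k = matrix_inv (transpose (B k) ** S (Suc k) ** B k + R k)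
                     ** transpose (B k) ** S (Suc k) ** A k"
begin

definition \<Lambda> :: "nat \<Rightarrow> real^'m^'m" where
  "\<Lambda> k = transpose (B k) ** S (Suc k) ** B k + R k"

lemma inner_\<Lambda>: "u \<bullet> (\<Lambda> k *v v) = (B k *v u) \<bullet> (S (Suc k) *v (B k *v v)) + u \<bullet> (R k *v v)"
  by (simp add: \<Lambda>_def matrix_vector_mult_add_rdistrib inner_add_right inner_vector_matrix_mult
      flip: matrix_vector_mul_assoc)

context
  fixes k assumes k: "k \<le> N" and S_psd: "psd (S (Suc k))"
begin

text \<open>The suffix \<open>_aux\<close> marks facts still resting on the assumption that
  \<open>S (Suc k)\<close> is positive semidefinite. They lead to the same property of
  \<open>S k\<close>, and the backward induction in \<open>S_psd\<close> then discharges the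
  assumption.\<close>

lemma \<Lambda>_pd_aux: "pd (\<Lambda> k)"
proof -
  have "transpose (X + Y) = transpose X + transpose Y" for X Y :: "real^'m^'m"
    by (simp add: transpose_def vec_eq_iff)
  then have "transpose (\<Lambda> k) = \<Lambda> k"
    using S_psd R_pd[OF k]
    by (simp add: \<Lambda>_def psd_def pd_def matrix_transpose_mul transpose_transpose matrix_mul_assoc)
  moreover have "0 < x \<bullet> (\<Lambda> k *v x)" if "x \<noteq> 0" for x
    using S_psd R_pd[OF k] that unfolding inner_\<Lambda> psd_def pd_def by (simp add: add_nonneg_pos)
  ultimately show ?thesis by (simp add: pd_def)
qed

text \<open>Since \<open>L k\<close> is the inverse of \<open>\<Lambda> k\<close> applied to
  \<open>B\<^sup>T S A\<close>, multiplying by \<open>\<Lambda> k\<close> clears the inverse. All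
  later algebra uses this relation instead of \<open>matrix_inv\<close>.\<close>

lemma \<Lambda>_L_aux: "u \<bullet> (\<Lambda> k *v (L k *v x)) = (B k *v u) \<bullet> (S (Suc k) *v (A k *v x))"
proof -
  have "\<Lambda> k ** L k = transpose (B k) ** S (Suc k) ** A k"
    unfolding L_eq[OF k] \<Lambda>_def[symmetric]
    by (simp add: matrix_mul_assoc pd_matrix_inv_right[OF \<Lambda>_pd_aux])
  then have "\<Lambda> k *v (L k *v x) = transpose (B k) *v (S (Suc k) *v (A k *v x))"
    by (simp add: matrix_vector_mul_assoc matrix_mul_assoc del: transpose_matrix_vector)
  then show ?thesis by (simp add: inner_vector_matrix_mult)
qed

text \<open>This is \<open>\<Gamma> = L\<^sup>T \<Lambda> L\<close>. It identifies the weight on the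
  estimation error with the loss caused by feeding back \<open>xhat\<close> in place of
  \<open>x\<close>.\<close>

lemma inner_\<Gamma>_aux: "x \<bullet> (\<Gamma> k *v y) = (L k *v x) \<bullet> (\<Lambda> k *v (L k *v y))"
proof -
  have "\<Gamma> k = transpose (A k) ** S (Suc k) ** B k ** L k"
    by (simp add: Gamma_eq[OF k] L_eq[OF k] matrix_mul_assoc)
  then have "x \<bullet> (\<Gamma> k *v y) = (A k *v x) \<bullet> (S (Suc k) *v (B k *v (L k *v y)))"
    by (simp add: inner_vector_matrix_mult flip: matrix_vector_mul_assoc)
  also have "\<dots> = (B k *v (L k *v y)) \<bullet> (S (Suc k) *v (A k *v x))"
    using S_psd by (intro symmetric_inner_commute) (simp add: psd_def)
  also have "\<dots> = (L k *v y) \<bullet> (\<Lambda> k *v (L k *v x))"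
    by (simp add: \<Lambda>_L_aux)
  also have "\<dots> = (L k *v x) \<bullet> (\<Lambda> k *v (L k *v y))"
    using \<Lambda>_pd_aux by (intro symmetric_inner_commute) (simp add: pd_def)
  finally show ?thesis .
qed

text \<open>The one-step identity of linear-quadratic control: \<open>\<Lambda>_L_aux\<close> makes
  the cross terms in \<open>x\<close> and \<open>u\<close> agree, and the term left over,
  \<open>\<Gamma> k\<close>, is exactly what the Riccati recursion subtracts.\<close>

lemma complete_square_aux:
  "x \<bullet> (Q k *v x) + u \<bullet> (R k *v u) + (A k *v x + B k *v u) \<bullet> (S (Suc k) *v (A k *v x + B k *v u))
   = x \<bullet> (S k *v x) + (u + L k *v x) \<bullet> (\<Lambda> k *v (u + L k *v x))"
proof -
  have S: "x \<bullet> (S k *v x) = x \<bullet> (Q k *v x) + (A k *v x) \<bullet> (S (Suc k) *v (A k *v x)) - x \<bullet> (\<Gamma> k *v x)"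
    by (simp add: S_rec[OF k] matrix_vector_mult_add_rdistrib matrix_vector_mult_diff_rdistrib
        inner_add_right inner_diff_right inner_vector_matrix_mult flip: matrix_vector_mul_assoc)
  have "(L k *v x) \<bullet> (\<Lambda> k *v u) = u \<bullet> (\<Lambda> k *v (L k *v x))"
    using \<Lambda>_pd_aux by (intro symmetric_inner_commute) (simp add: pd_def)
  moreover have "(A k *v x) \<bullet> (S (Suc k) *v (B k *v u)) = (B k *v u) \<bullet> (S (Suc k) *v (A k *v x))"
    using S_psd by (intro symmetric_inner_commute) (simp add: psd_def)
  ultimately show ?thesis
    using inner_\<Lambda>[of u k u] \<Lambda>_L_aux[of u x]
    by (simp add: S inner_\<Gamma>_aux matrix_vector_right_distrib inner_add_left inner_add_right)
qed

text \<open>Symmetry of \<open>\<Gamma> k\<close> is read off from its form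
  \<open>L\<^sup>T \<Lambda> L\<close>, which avoids transposing an inverse matrix.\<close>

lemma S_psd_aux: "psd (S k)"
proof -
  have trA: "transpose (X + Y) = transpose X + transpose Y" "transpose (X - Y) = transpose X - transpose Y" for X Y :: "real^'n^'n"
    by (simp_all add: transpose_def vec_eq_iff)
  have "transpose (S k) = S k"
  proof -
    have sym: "x \<bullet> (\<Gamma> k *v y) = y \<bullet> (\<Gamma> k *v x)" for x y
      by (simp only: inner_\<Gamma>_aux) (use \<Lambda>_pd_aux in \<open>auto intro!: symmetric_inner_commute simp: pd_def\<close>)
    have tr: "x \<bullet> (transpose (\<Gamma> k) *v y) = x \<bullet> (\<Gamma> k *v y)" for x y
      unfolding sym[of x y] by (simp add: inner_vector_matrix_mult inner_commute)
    have "transpose (\<Gamma> k) *v y = \<Gamma> k *v y" for y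
      by (rule iffD1[OF vector_eq_ldot]) (simp only: tr simp_thms)
    then have "transpose (\<Gamma> k) = \<Gamma> k"
      by (intro iffD2[OF matrix_eq] allI)
    moreover have "transpose (S (Suc k)) = S (Suc k)" "transpose (Q k) = Q k"
      using S_psd Q_psd[of k] k by (auto simp: psd_def)
    ultimately show ?thesis
      by (simp only: S_rec[OF k] trA matrix_transpose_mul transpose_transpose matrix_mul_assoc)
  qed
  moreover have "0 \<le> x \<bullet> (S k *v x)" for x
  proof -
    \<comment> \<open>The optimal feedback annihilates the completed square, so the quadratic form
      of \<open>S k\<close> equals a sum of nonnegative terms.\<close>
    let ?u = "- (L k *v x)"
    have "?u + L k *v x = 0" by simp
    then have eq: "x \<bullet> (S k *v x) = x \<bullet> (Q k *v x) + ?u \<bullet> (R k *v ?u)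
        + (A k *v x + B k *v ?u) \<bullet> (S (Suc k) *v (A k *v x + B k *v ?u))"
      using complete_square_aux[of x ?u] by (simp only: inner_zero_left add_0_right)
    have nonneg: "psd X \<Longrightarrow> 0 \<le> y \<bullet> (X *v y)" for X :: "real^'b^'b" and y by (simp add: psd_def)
    show ?thesis
      unfolding eq using Q_psd[of k] pd_imp_psd[OF R_pd[OF k]] S_psd k
      by (intro add_nonneg_nonneg nonneg) auto
  qed
  ultimately show ?thesis by (simp add: psd_def)
qed

end

lemma S_psd: "k \<le> Suc N \<Longrightarrow> psd (S k)"
proof (induction rule: inc_induct)
  case base
  then show ?case by (simp add: S_final Q_psd)
next
  case (step k)
  then show ?case using S_psd_aux[of k] by auto
qed

lemma Q_nonneg: "k \<le> Suc N \<Longrightarrow> 0 \<le> v \<bullet> (Q k *v v)"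
  using Q_psd[of k] by (simp add: psd_def)

lemma R_nonneg: "k \<le> N \<Longrightarrow> 0 \<le> v \<bullet> (R k *v v)"
  using pd_imp_psd[OF R_pd[of k]] by (simp add: psd_def)

lemma \<Lambda>_pd: "k \<le> N \<Longrightarrow> pd (\<Lambda> k)"
  by (rule \<Lambda>_pd_aux) (auto intro: S_psd)

lemma inner_\<Gamma>: "k \<le> N \<Longrightarrow> x \<bullet> (\<Gamma> k *v x) = (L k *v x) \<bullet> (\<Lambda> k *v (L k *v x))"
  by (rule inner_\<Gamma>_aux) (auto intro: S_psd)

lemma \<Gamma>_nonneg: "k \<le> Suc N \<Longrightarrow> 0 \<le> x \<bullet> (\<Gamma> k *v x)"
proof (cases "k = Suc N")
  case False
  assume "k \<le> Suc N"
  with False have "k \<le> N" by simp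
  with pd_imp_psd[OF \<Lambda>_pd] show ?thesis by (simp add: psd_def inner_\<Gamma>)
qed (simp add: Gamma_final)

lemma complete_square:
  assumes "k \<le> N"
  shows "x \<bullet> (Q k *v x) + u \<bullet> (R k *v u) + (A k *v x + B k *v u) \<bullet> (S (Suc k) *v (A k *v x + B k *v u))
   = x \<bullet> (S k *v x) + (u + L k *v x) \<bullet> (\<Lambda> k *v (u + L k *v x))"
  by (rule complete_square_aux) (use assms S_psd in auto)

end

section \<open>The noise model and the value function\<close>

definition square_integrable :: "'a measure \<Rightarrow> ('a \<Rightarrow> 'b::euclidean_space) \<Rightarrow> bool" where
  "square_integrable M X \<longleftrightarrow> X \<in> borel_measurable M \<and> integrable M (\<lambda>\<omega>. (norm (X \<omega>))\<^sup>2)"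

lemma square_integrable_measurable [measurable_dest]:
  "square_integrable M X \<Longrightarrow> X \<in> borel_measurable M"
  by (simp add: square_integrable_def)

lemma square_integrable_bound:
  assumes "X \<in> borel_measurable M" "integrable M f" "\<And>\<omega>. \<omega> \<in> space M \<Longrightarrow> (norm (X \<omega>))\<^sup>2 \<le> f \<omega>"
  shows "square_integrable M X"
  unfolding square_integrable_def
proof (intro conjI Bochner_Integration.integrable_bound[OF assms(2)])
  show "AE \<omega> in M. norm ((norm (X \<omega>))\<^sup>2) \<le> norm (f \<omega>)"
    using assms(3) by (intro AE_I2) (auto intro: order_trans[OF _ abs_ge_self])
qed (use assms(1) in measurable)

lemma square_integrable_cong:
  "(\<And>\<omega>. \<omega> \<in> space M \<Longrightarrow> X \<omega> = Y \<omega>) \<Longrightarrow> square_integrable M X \<longleftrightarrow> square_integrable M Y"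
  unfolding square_integrable_def
  by (intro arg_cong2[where f="(\<and>)"] measurable_cong Bochner_Integration.integrable_cong) auto

lemma square_integrable_add:
  assumes "square_integrable M X" "square_integrable M Y"
  shows "square_integrable M (\<lambda>\<omega>. X \<omega> + Y \<omega>)"
proof (rule square_integrable_bound)
  show "integrable M (\<lambda>\<omega>. 2 * (norm (X \<omega>))\<^sup>2 + 2 * (norm (Y \<omega>))\<^sup>2)"
    using assms by (simp add: square_integrable_def)
  fix \<omega>
  have "(norm (X \<omega> + Y \<omega>))\<^sup>2 \<le> (norm (X \<omega>) + norm (Y \<omega>))\<^sup>2"
    by (intro power_mono norm_triangle_ineq) auto
  also have "\<dots> \<le> 2 * (norm (X \<omega>))\<^sup>2 + 2 * (norm (Y \<omega>))\<^sup>2"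
    using sum_squares_bound[of "norm (X \<omega>)" "norm (Y \<omega>)"] by (simp add: power2_sum)
  finally show "(norm (X \<omega> + Y \<omega>))\<^sup>2 \<le> 2 * (norm (X \<omega>))\<^sup>2 + 2 * (norm (Y \<omega>))\<^sup>2" .
qed (use assms in measurable)

lemma square_integrable_bounded_linear:
  assumes "bounded_linear f" "square_integrable M X"
  shows "square_integrable M (\<lambda>\<omega>. f (X \<omega>))"
proof -
  obtain K where K: "\<And>x. norm (f x) \<le> norm x * K" using bounded_linear.bounded[OF assms(1)] by blast
  show ?thesis
  proof (rule square_integrable_bound)
    show "(\<lambda>\<omega>. f (X \<omega>)) \<in> borel_measurable M"
      by (rule measurable_compose[OF square_integrable_measurable[OF assms(2)]])
         (intro borel_measurable_continuous_onI linear_continuous_on assms(1))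
    show "integrable M (\<lambda>\<omega>. K\<^sup>2 * (norm (X \<omega>))\<^sup>2)"
      using assms by (simp add: square_integrable_def)
    show "(norm (f (X \<omega>)))\<^sup>2 \<le> K\<^sup>2 * (norm (X \<omega>))\<^sup>2" for \<omega>
      using power_mono[OF K norm_ge_zero, of "X \<omega>" 2] by (simp add: power_mult_distrib mult.commute)
  qed
qed

lemma square_integrable_mult_vec:
  "square_integrable M X \<Longrightarrow> square_integrable M (\<lambda>\<omega>. (K :: real^'n^'m) *v X \<omega>)"
  by (rule square_integrable_bounded_linear[OF matrix_vector_mul_bounded_linear])

lemma square_integrable_minus: "square_integrable M X \<Longrightarrow> square_integrable M (\<lambda>\<omega>. - X \<omega>)"
  by (simp add: square_integrable_def)

lemma square_integrable_diff:
  "square_integrable M X \<Longrightarrow> square_integrable M Y \<Longrightarrow> square_integrable M (\<lambda>\<omega>. X \<omega> - Y \<omega>)"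
  using square_integrable_add[of M X "\<lambda>\<omega>. - Y \<omega>"] square_integrable_minus[of M Y] by simp

lemma square_integrable_if:
  assumes "square_integrable M X" "square_integrable M Y" "Measurable.pred M P"
  shows "square_integrable M (\<lambda>\<omega>. if P \<omega> then X \<omega> else Y \<omega>)"
proof (rule square_integrable_bound)
  show "integrable M (\<lambda>\<omega>. (norm (X \<omega>))\<^sup>2 + (norm (Y \<omega>))\<^sup>2)"
    using assms by (simp add: square_integrable_def)
  show "(\<lambda>\<omega>. if P \<omega> then X \<omega> else Y \<omega>) \<in> borel_measurable M" using assms by measurable
qed auto

lemma (in finite_measure) square_integrable_const: "square_integrable M (\<lambda>_. c)"
  by (simp add: square_integrable_def)

lemma integrable_inner_square_integrable:
  assumes "square_integrable M X" "square_integrable M Y"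
  shows "integrable M (\<lambda>\<omega>. X \<omega> \<bullet> Y \<omega>)"
proof (rule Bochner_Integration.integrable_bound)
  show "integrable M (\<lambda>\<omega>. (norm (X \<omega>))\<^sup>2 + (norm (Y \<omega>))\<^sup>2)"
    using assms by (simp add: square_integrable_def)
  have "\<bar>X \<omega> \<bullet> Y \<omega>\<bar> \<le> (norm (X \<omega>))\<^sup>2 + (norm (Y \<omega>))\<^sup>2" for \<omega>
    using Cauchy_Schwarz_ineq2[of "X \<omega>" "Y \<omega>"] sum_squares_bound[of "norm (X \<omega>)" "norm (Y \<omega>)"]
      mult_nonneg_nonneg[OF norm_ge_zero norm_ge_zero, of "X \<omega>" "Y \<omega>"] by linarith
  then show "AE \<omega> in M. norm (X \<omega> \<bullet> Y \<omega>) \<le> norm ((norm (X \<omega>))\<^sup>2 + (norm (Y \<omega>))\<^sup>2)"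
    by (intro AE_I2) simp
qed (use assms in measurable)

lemma integrable_quadratic_form:
  fixes X :: "'a \<Rightarrow> real^'n"
  shows "square_integrable M X \<Longrightarrow> integrable M (\<lambda>\<omega>. X \<omega> \<bullet> (K *v X \<omega>))"
  by (intro integrable_inner_square_integrable square_integrable_mult_vec)

lemma (in prob_space) integrable_inner_const:
  assumes "square_integrable M X"
  shows "integrable M (\<lambda>\<omega>. a \<bullet> X \<omega>)"
  by (rule integrable_inner_square_integrable[OF square_integrable_const assms])

lemma borel_measurable_mult_vec [measurable (raw)]:
  fixes f :: "'a \<Rightarrow> real^'n"
  shows "f \<in> borel_measurable M \<Longrightarrow> (\<lambda>x. (K :: real^'n^'m) *v f x) \<in> borel_measurable M"
  by (rule measurable_compose[OF _ borel_measurable_continuous_onI[OF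
        linear_continuous_on[OF matrix_vector_mul_bounded_linear]]])

lemma mult_vec_uminus [simp]: "(K :: real^'n^'m) *v (- z) = - (K *v z)"
  by (rule linear_neg[OF matrix_vector_mul_linear])

section \<open>Sigma-algebras generated by families of random elements\<close>

lemma space_gen_alg [simp]: "space (gen_alg M N X I) = space M"
  by (simp add: gen_alg_def)

lemma gen_alg_component:
  assumes "i \<in> I" "\<And>j. j \<in> I \<Longrightarrow> X j \<in> space M \<rightarrow> space N"
  shows "X i \<in> measurable (gen_alg M N X I) N"
proof -
  have "(\<lambda>\<omega>. \<lambda>i\<in>I. X i \<omega>) \<in> measurable (gen_alg M N X I) (Pi\<^sub>M I (\<lambda>_. N))"
    unfolding gen_alg_def
    by (intro measurable_vimage_algebra1) (auto simp: space_PiM intro: funcset_mem[OF assms(2)])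
  from measurable_compose[OF this measurable_component_singleton[OF assms(1)]] assms(1)
  show ?thesis by simp
qed

lemma sets_gen_alg:
  assumes "\<And>j. j \<in> I \<Longrightarrow> X j \<in> space M \<rightarrow> space N"
  shows "sets (gen_alg M N X I) = {(\<lambda>\<omega>. \<lambda>i\<in>I. X i \<omega>) -` E \<inter> space M | E. E \<in> sets (Pi\<^sub>M I (\<lambda>_. N))}"
  unfolding gen_alg_def by (intro sets_vimage_algebra2) (auto simp: space_PiM intro: funcset_mem[OF assms])

text \<open>Minimality of the generated sigma-algebra. Every inclusion between information
  structures below is reduced to measurability of the generators.\<close>

lemma gen_alg_subalgebra:
  assumes sp: "space G = space M" and X: "\<And>j. j \<in> I \<Longrightarrow> X j \<in> measurable G N"
  shows "subalgebra G (gen_alg M N X I)"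
  unfolding subalgebra_def
proof safe
  fix D assume D: "D \<in> sets (gen_alg M N X I)"
  have "(\<lambda>\<omega>. \<lambda>i\<in>I. X i \<omega>) \<in> measurable G (Pi\<^sub>M I (\<lambda>_. N))"
    by (intro measurable_restrict X)
  moreover have "X j \<in> space M \<rightarrow> space N" if "j \<in> I" for j
    using measurable_space[OF X[OF that]] sp by auto
  ultimately show "D \<in> sets G"
    using D sp by (auto simp: sets_gen_alg dest: measurable_sets)
qed (simp_all add: sp)

text \<open>Gaussianity enters only through symmetry and finite second moments.\<close>
locale event_trigger_model = prob_space M + riccati A B Q R N S \<Gamma> L
  for M :: "'a measure"
    and A :: "nat \<Rightarrow> real^'n^'n" and B :: "nat \<Rightarrow> real^'m^'n"
    and Q :: "nat \<Rightarrow> real^'n^'n" and R :: "nat \<Rightarrow> real^'m^'m" and N :: nat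
    and S :: "nat \<Rightarrow> real^'n^'n" and \<Gamma> :: "nat \<Rightarrow> real^'n^'n" and L :: "nat \<Rightarrow> real^'n^'m" +
  fixes m0 :: "real^'n" and x0 :: "'a \<Rightarrow> real^'n" and w :: "nat \<Rightarrow> 'a \<Rightarrow> real^'n" and \<theta> :: "nat \<Rightarrow> real"
  assumes x0_sq: "square_integrable M (\<lambda>\<omega>. x0 \<omega> - m0)"
    and x0_sym: "distr M borel (\<lambda>\<omega>. x0 \<omega> - m0) = distr M borel (\<lambda>\<omega>. - (x0 \<omega> - m0))"
    and w_sq: "k \<le> N \<Longrightarrow> square_integrable M (w k)"
    and w_sym: "k \<le> N \<Longrightarrow> distr M borel (w k) = distr M borel (\<lambda>\<omega>. - w k \<omega>)"
    and indep: "indep_vars (\<lambda>_. borel) (\<lambda>i. case i of None \<Rightarrow> x0 | Some k \<Rightarrow> w k) (insert None (Some ` {..N}))"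
    and theta_nonneg: "k \<le> N \<Longrightarrow> 0 \<le> \<theta> k"
begin

text \<open>The history of the exogenous randomness strictly before \<open>w k\<close>. Unlike
  \<open>info_e\<close> and \<open>info_c\<close> it does not depend on the policies, so its
  independence of \<open>w k\<close> comes directly from the noise model. The \<open>option\<close>
  index matches the one in the independence assumption.\<close>

definition F :: "nat \<Rightarrow> 'a measure" where
  "F k = gen_alg M borel (\<lambda>i. case i of None \<Rightarrow> x0 | Some k \<Rightarrow> w k) (insert None (Some ` {..<k}))"

lemma space_F [simp]: "space (F k) = space M"
  by (simp add: F_def)

lemma w_measurable: "k \<le> N \<Longrightarrow> w k \<in> borel_measurable M"
  by (intro square_integrable_measurable w_sq)

lemma x0_measurable: "x0 \<in> borel_measurable M"
  using borel_measurable_add[OF square_integrable_measurable[OF x0_sq] borel_measurable_const[of m0]] by simp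

lemma x0_F: "x0 \<in> borel_measurable (F k)"
  unfolding F_def using gen_alg_component[of None "insert None (Some ` {..<k})"
    "\<lambda>i. case i of None \<Rightarrow> x0 | Some k \<Rightarrow> w k" M borel] by simp

lemma w_F: "t < k \<Longrightarrow> w t \<in> borel_measurable (F k)"
  unfolding F_def using gen_alg_component[of "Some t" "insert None (Some ` {..<k})"
    "\<lambda>i. case i of None \<Rightarrow> x0 | Some k \<Rightarrow> w k" M borel] by simp

lemma subalgebra_F: "k \<le> Suc N \<Longrightarrow> subalgebra M (F k)"
  unfolding F_def
  by (intro gen_alg_subalgebra) (auto simp: x0_measurable w_measurable split: option.split)

lemma F_mono: "k \<le> l \<Longrightarrow> subalgebra (F l) (F k)"
  by (subst (2) F_def, intro gen_alg_subalgebra) (auto simp: x0_F w_F split: option.split)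

text \<open>Joint independence is grouped into two blocks, the generators of \<open>F k\<close> and
  the single index \<open>Some k\<close>; events of \<open>F k\<close> are preimages under the first
  block.\<close>

lemma indep_F:
  assumes k: "k \<le> N" and D: "D \<in> sets (F k)" and E [measurable]: "E \<in> sets borel"
  shows "prob (D \<inter> (w k -` E \<inter> space M)) = prob D * prob (w k -` E \<inter> space M)"
proof -
  let ?I = "insert None (Some ` {..<k})"
  define Y where "Y = (\<lambda>i. case i of None \<Rightarrow> x0 | Some k \<Rightarrow> w k)"
  define X where "X = (\<lambda>\<omega>. \<lambda>i\<in>?I. Y i \<omega>)"
  define X' where "X' = (\<lambda>\<omega>. \<lambda>i\<in>{Some k}. Y i \<omega>)"
  define E' where "E' = (\<lambda>f. f (Some k)) -` E \<inter> space (PiM {Some k} (\<lambda>_. borel))"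
  have ind: "indep_var (PiM ?I (\<lambda>_. borel)) X (PiM {Some k} (\<lambda>_. borel)) X'"
    unfolding X_def X'_def Y_def using k by (intro indep_var_restrict[OF indep]) auto
  have "sets (F k) = {X -` D' \<inter> space M | D'. D' \<in> sets (PiM ?I (\<lambda>_. borel))}"
    unfolding F_def X_def Y_def by (rule sets_gen_alg) simp
  then obtain D' where D': "D = X -` D' \<inter> space M" "D' \<in> sets (PiM ?I (\<lambda>_. borel))"
    using D by blast
  have E': "E' \<in> sets (PiM {Some k} (\<lambda>_. borel))"
    unfolding E'_def using measurable_component_singleton[of "Some k" "{Some k}" "\<lambda>_. borel"]
    by (intro measurable_sets[OF _ E]) auto
  have "X' \<omega> \<in> E' \<longleftrightarrow> w k \<omega> \<in> E" for \<omega>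
    by (simp add: X'_def E'_def Y_def space_PiM)
  then have "w k -` E \<inter> space M = X' -` E' \<inter> space M"
    "D \<inter> (w k -` E \<inter> space M) = (\<lambda>\<omega>. (X \<omega>, X' \<omega>)) -` (D' \<times> E') \<inter> space M"
    unfolding D'(1) by auto
  then show ?thesis
    using indep_varD[OF ind D'(2) E'] D'(1) by simp
qed

text \<open>The freezing lemma: whatever is \<open>F k\<close>-measurable may be held fixed while
  \<open>w k\<close> is averaged. Letting \<open>f\<close> take the sample point itself as its first
  argument allows any number of \<open>F k\<close>-measurable quantities to be frozen at
  once.\<close>

lemma nn_integral_indep_F:
  assumes k: "k \<le> N" and f [measurable]: "f \<in> borel_measurable (F k \<Otimes>\<^sub>M borel)"
  shows "(\<integral>\<^sup>+\<omega>. f (\<omega>, w k \<omega>) \<partial>M) = (\<integral>\<^sup>+\<omega>. \<integral>\<^sup>+\<omega>'. f (\<omega>, w k \<omega>') \<partial>M \<partial>M)"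
proof -
  have rv [measurable]: "(\<lambda>\<omega>. \<omega>) \<in> measurable M (F k)" "w k \<in> borel_measurable M"
    using measurable_from_subalg[OF subalgebra_F, of k "\<lambda>\<omega>. \<omega>" "F k"] k by (auto intro: w_measurable)
  interpret D: prob_space "distr M (F k) (\<lambda>\<omega>. \<omega>)" by (rule prob_space_distr) measurable
  interpret W: prob_space "distr M borel (w k)" by (rule prob_space_distr) measurable
  \<comment> \<open>Regarded as a random element with values in the sample space equipped with
    \<open>F k\<close>, the identity is independent of \<open>w k\<close>; hence the joint law is a
    product, checked on rectangles.\<close>
  have d: "distr M (F k) (\<lambda>\<omega>. \<omega>) \<Otimes>\<^sub>M distr M borel (w k) = distr M (F k \<Otimes>\<^sub>M borel) (\<lambda>\<omega>. (\<omega>, w k \<omega>))"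
  proof (rule pair_measure_eqI)
    fix D E assume "D \<in> sets (distr M (F k) (\<lambda>\<omega>. \<omega>))" "E \<in> sets (distr M borel (w k))"
    then have DE: "D \<in> sets (F k)" "E \<in> sets borel" by auto
    then have D: "D \<inter> space M = D" using sets.sets_into_space[of D "F k"] by auto
    have "(\<lambda>\<omega>. (\<omega>, w k \<omega>)) -` (D \<times> E) \<inter> space M = D \<inter> (w k -` E \<inter> space M)" by auto
    then show "emeasure (distr M (F k) (\<lambda>\<omega>. \<omega>)) D * emeasure (distr M borel (w k)) E
      = emeasure (distr M (F k \<Otimes>\<^sub>M borel) (\<lambda>\<omega>. (\<omega>, w k \<omega>))) (D \<times> E)"
      using DE indep_F[OF k DE]
      by (simp add: emeasure_distr emeasure_eq_measure D ennreal_mult'')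
  qed (auto intro: D.sigma_finite_measure_axioms W.sigma_finite_measure_axioms)
  have "(\<integral>\<^sup>+\<omega>. f (\<omega>, w k \<omega>) \<partial>M) = (\<integral>\<^sup>+p. f p \<partial>distr M (F k \<Otimes>\<^sub>M borel) (\<lambda>\<omega>. (\<omega>, w k \<omega>)))"
    by (subst nn_integral_distr) auto
  also have "\<dots> = (\<integral>\<^sup>+\<omega>. \<integral>\<^sup>+v. f (\<omega>, v) \<partial>distr M borel (w k) \<partial>distr M (F k) (\<lambda>\<omega>. \<omega>))"
    unfolding d[symmetric] by (subst W.nn_integral_fst[symmetric]) auto
  also have "\<dots> = (\<integral>\<^sup>+\<omega>. \<integral>\<^sup>+v. f (\<omega>, v) \<partial>distr M borel (w k) \<partial>M)"
    by (subst nn_integral_distr) auto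
  also have "\<dots> = (\<integral>\<^sup>+\<omega>. \<integral>\<^sup>+\<omega>'. f (\<omega>, w k \<omega>') \<partial>M \<partial>M)"
  proof (rule nn_integral_cong)
    fix \<omega> assume "\<omega> \<in> space M"
    then have "(\<lambda>v. f (\<omega>, v)) \<in> borel_measurable borel" by (intro measurable_Pair2[OF f]) simp
    then show "(\<integral>\<^sup>+v. f (\<omega>, v) \<partial>distr M borel (w k)) = (\<integral>\<^sup>+\<omega>'. f (\<omega>, w k \<omega>') \<partial>M)"
      by (intro nn_integral_distr) auto
  qed
  finally show ?thesis .
qed

lemma w_symmetric_integral:
  fixes f :: "real^'n \<Rightarrow> real"
  assumes k: "k \<le> N" and [measurable]: "f \<in> borel_measurable borel"
  shows "(\<integral>\<omega>. f (- w k \<omega>) \<partial>M) = (\<integral>\<omega>. f (w k \<omega>) \<partial>M)"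
proof -
  have [measurable]: "w k \<in> borel_measurable M" by (rule w_measurable[OF k])
  show ?thesis
    using arg_cong[OF w_sym[OF k], of "\<lambda>D. integral\<^sup>L D f"] by (subst (asm) (1 2) integral_distr) auto
qed

lemma w_symmetric_nn_integral:
  assumes k: "k \<le> N" and [measurable]: "f \<in> borel_measurable borel"
  shows "(\<integral>\<^sup>+\<omega>. f (- w k \<omega>) \<partial>M) = (\<integral>\<^sup>+\<omega>. f (w k \<omega>) \<partial>M)"
proof -
  have [measurable]: "w k \<in> borel_measurable M" by (rule w_measurable[OF k])
  show ?thesis
    using arg_cong[OF w_sym[OF k], of "\<lambda>D. integral\<^sup>N D f"] by (subst (asm) (1 2) nn_integral_distr) auto
qed

lemma w_mean: "k \<le> N \<Longrightarrow> (\<integral>\<omega>. a \<bullet> w k \<omega> \<partial>M) = 0"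
  using w_symmetric_integral[of k "\<lambda>v. a \<bullet> v"] by simp

text \<open>With \<open>a\<close> frozen, symmetry of the noise gives the positive and negative
  parts the same integral. Square integrability makes both finite, so their difference is
  zero.\<close>

lemma expectation_inner_noise:
  assumes k: "k \<le> N" and a: "a \<in> borel_measurable (F k)" "square_integrable M a"
  shows "(\<integral>\<omega>. a \<omega> \<bullet> w k \<omega> \<partial>M) = 0"
proof -
  have [measurable]: "w k \<in> borel_measurable M" "a \<in> borel_measurable (F k)"
    using a(1) by (auto intro: w_measurable[OF k])
  have "(\<integral>\<^sup>+\<omega>. ennreal (a \<omega> \<bullet> w k \<omega>) \<partial>M) = (\<integral>\<^sup>+\<omega>. \<integral>\<^sup>+\<omega>'. ennreal (a \<omega> \<bullet> w k \<omega>') \<partial>M \<partial>M)"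
    using nn_integral_indep_F[OF k, of "\<lambda>(\<omega>, v). ennreal (a \<omega> \<bullet> v)"] by simp
  also have "\<dots> = (\<integral>\<^sup>+\<omega>. \<integral>\<^sup>+\<omega>'. ennreal (- (a \<omega> \<bullet> w k \<omega>')) \<partial>M \<partial>M)"
    using w_symmetric_nn_integral[OF k, of "\<lambda>v. ennreal (a \<omega> \<bullet> v)" for \<omega>] by simp
  also have "\<dots> = (\<integral>\<^sup>+\<omega>. ennreal (- (a \<omega> \<bullet> w k \<omega>)) \<partial>M)"
    using nn_integral_indep_F[OF k, of "\<lambda>(\<omega>, v). ennreal (- (a \<omega> \<bullet> v))"] by simp
  finally show ?thesis
    using integrable_inner_square_integrable[OF a(2) w_sq[OF k]] by (simp add: real_lebesgue_integral_def)
qed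

text \<open>Averaging over symmetric noise preserves evenness; this is the step by which evenness
  travels backwards through the Bellman recursion.\<close>

lemma noise_average_uminus:
  fixes f :: "real^'n \<Rightarrow> real"
  assumes k: "k \<le> N" and [measurable]: "f \<in> borel_measurable borel" and even: "\<And>z. f (- z) = f z"
  shows "(\<integral>\<omega>. f (- y + w k \<omega>) \<partial>M) = (\<integral>\<omega>. f (y + w k \<omega>) \<partial>M)"
proof -
  have "(\<integral>\<omega>. f (- y + w k \<omega>) \<partial>M) = (\<integral>\<omega>. f (y + - w k \<omega>) \<partial>M)"
    using even[of "y - w k _"] by simp
  also have "\<dots> = (\<integral>\<omega>. f (y + w k \<omega>) \<partial>M)"
    by (rule w_symmetric_integral[OF k]) measurable
  finally show ?thesis .
qed

section \<open>Bellman recursion and the value of information\<close>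

abbreviation "V \<equiv> Ve M w A \<Gamma> \<theta> N"
abbreviation "voi \<equiv> VoI M w A \<Gamma> \<theta> N"

text \<open>\<open>cont k (A k *v e)\<close> and \<open>cont k 0\<close> are the continuation costs of the Bellman recursion
  without and with a transmission at time \<open>k\<close>.\<close>
definition stage :: "nat \<Rightarrow> real^'n \<Rightarrow> real" where
  "stage k z = z \<bullet> (\<Gamma> (Suc k) *v z) + V (Suc k) z"

definition cont :: "nat \<Rightarrow> real^'n \<Rightarrow> real" where
  "cont k y = (\<integral>\<omega>. stage k (y + w k \<omega>) \<partial>M)"

lemma V_final: "V (Suc N) e = 0"
  by (simp add: Ve_def)

lemma V_rec: "k \<le> N \<Longrightarrow> V k e = min (cont k (A k *v e)) (\<theta> k + cont k 0)"
  by (simp add: Ve_def Suc_diff_le Let_def cont_def stage_def)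

text \<open>The properties are carried together through the backward induction because each step
  averages the next value function. The upper bound comes from the option to transmit, whose cost
  \<open>\<theta> k + cont k 0\<close> does not depend on the error; boundedness later gives
  integrability of \<open>V\<close> at any random argument.\<close>

lemma V_properties:
  "k \<le> Suc N \<Longrightarrow> V k \<in> borel_measurable borel \<and> (\<forall>e. 0 \<le> V k e) \<and> (\<exists>C. \<forall>e. V k e \<le> C)
     \<and> (\<forall>e. V k (- e) = V k e)"
proof (induction rule: inc_induct)
  case base
  show ?case by (auto simp: V_final[abs_def])
next
  case (step k)
  then have k: "k \<le> N" by simp
  have [measurable]: "w k \<in> borel_measurable M" by (rule w_measurable[OF k])
  have [measurable]: "V (Suc k) \<in> borel_measurable borel" using step by simp
  have [measurable]: "stage k \<in> borel_measurable borel" unfolding stage_def by measurable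
  have nonneg: "0 \<le> stage k z" for z
    using step k by (auto simp: stage_def intro!: add_nonneg_nonneg \<Gamma>_nonneg)
  have even: "stage k (- z) = stage k z" for z
    using step by (simp add: stage_def)
  have "cont k \<in> borel_measurable borel"
    unfolding cont_def by measurable
  then have "V k \<in> borel_measurable borel"
    unfolding V_rec[OF k, abs_def] by measurable
  moreover have "0 \<le> cont k y" for y unfolding cont_def by (intro integral_nonneg_AE AE_I2 nonneg)
  then have "0 \<le> V k e" for e using theta_nonneg[OF k] by (simp add: V_rec[OF k])
  moreover have "\<forall>e. V k e \<le> \<theta> k + cont k 0" by (simp add: V_rec[OF k])
  moreover have "cont k (- y) = cont k y" for y
    unfolding cont_def by (rule noise_average_uminus[where f="stage k", OF k]) (measurable, rule even)
  then have "V k (- e) = V k e" for e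
    by (simp add: V_rec[OF k])
  ultimately show ?case by blast
qed

lemma V_integrable:
  assumes "k \<le> Suc N" and [measurable]: "X \<in> borel_measurable M"
  shows "integrable M (\<lambda>\<omega>. V k (X \<omega>))"
proof -
  have [measurable]: "V k \<in> borel_measurable borel" using V_properties[OF assms(1)] by simp
  obtain C where "\<And>e. V k e \<le> C" "\<And>e. 0 \<le> V k e" using V_properties[OF assms(1)] by auto
  then show ?thesis by (intro integrable_const_bound[where B=C]) auto
qed

context
  fixes k assumes k: "k \<le> N"
begin

lemma V_Suc_measurable [measurable]: "V (Suc k) \<in> borel_measurable borel"
  using V_properties[of "Suc k"] k by simp

lemma stage_measurable [measurable]: "stage k \<in> borel_measurable borel"
  unfolding stage_def by measurable

lemma stage_nonneg: "0 \<le> stage k z"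
  using V_properties[of "Suc k"] k by (auto simp: stage_def intro!: add_nonneg_nonneg \<Gamma>_nonneg)

lemma stage_integrable: "square_integrable M X \<Longrightarrow> integrable M (\<lambda>\<omega>. stage k (X \<omega>))"
  unfolding stage_def
  by (intro Bochner_Integration.integrable_add integrable_quadratic_form V_integrable square_integrable_measurable)
     (use k in auto)

lemma stage_shift_integrable: "integrable M (\<lambda>\<omega>. stage k (y + w k \<omega>))"
  by (intro stage_integrable square_integrable_add square_integrable_const w_sq k)

lemma cont_measurable [measurable]: "cont k \<in> borel_measurable borel"
proof -
  have [measurable]: "w k \<in> borel_measurable M" by (rule w_measurable[OF k])
  show ?thesis unfolding cont_def by measurable
qed

lemma cont_uminus: "cont k (- y) = cont k y"
proof -
  have even: "stage k (- z) = stage k z" for z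
    using V_properties[of "Suc k"] k by (simp add: stage_def)
  show ?thesis
    unfolding cont_def by (rule noise_average_uminus[where f="stage k", OF k]) (measurable, rule even)
qed

text \<open>In the quadratic form at \<open>A k e + w k\<close> the part linear in the noise has
  mean zero, and the pure noise part also occurs in the transmission branch and cancels. So VoI is
  the expected cost of silence minus that of transmission, and its sign selects the smaller branch
  of the Bellman minimum.\<close>

lemma voi_eq: "voi k e = cont k (A k *v e) - (\<theta> k + cont k 0)"
proof -
  let ?G = "\<Gamma> (Suc k)" and ?y = "A k *v e"
  have [measurable]: "w k \<in> borel_measurable M" by (rule w_measurable[OF k])
  have wi: "integrable M (\<lambda>\<omega>. w k \<omega> \<bullet> (?G *v w k \<omega>))"
    by (intro integrable_quadratic_form w_sq k)
  have lin: "integrable M (\<lambda>\<omega>. (?y v* ?G + ?G *v ?y) \<bullet> w k \<omega>)"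
    by (intro integrable_inner_const w_sq k)
  \<comment> \<open>Both cross terms are collected into one linear functional of \<open>v\<close>,
    to which the zero mean of the noise applies.\<close>
  have expand: "stage k (?y + v) = (?y \<bullet> (?G *v ?y) + (?y v* ?G + ?G *v ?y) \<bullet> v + v \<bullet> (?G *v v))
      + V (Suc k) (?y + v)" for v
    using inner_commute[of v "?G *v ?y"]
    by (simp add: stage_def matrix_vector_right_distrib inner_add_left inner_add_right dot_lmul_matrix)
  have "cont k ?y = (\<integral>\<omega>. (?y \<bullet> (?G *v ?y) + (?y v* ?G + ?G *v ?y) \<bullet> w k \<omega> + w k \<omega> \<bullet> (?G *v w k \<omega>))
      + V (Suc k) (?y + w k \<omega>) \<partial>M)"
    unfolding cont_def by (simp only: expand)
  also have "\<dots> = ?y \<bullet> (?G *v ?y) + (\<integral>\<omega>. w k \<omega> \<bullet> (?G *v w k \<omega>) \<partial>M) + (\<integral>\<omega>. V (Suc k) (?y + w k \<omega>) \<partial>M)"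
    using wi lin w_mean[OF k, of "?y v* ?G + ?G *v ?y"] k by (simp add: V_integrable prob_space)
  finally have y: "cont k ?y = \<dots>" .
  have "cont k 0 = (\<integral>\<omega>. w k \<omega> \<bullet> (?G *v w k \<omega>) \<partial>M) + (\<integral>\<omega>. V (Suc k) (w k \<omega>) \<partial>M)"
    unfolding cont_def stage_def using wi k by (simp add: V_integrable)
  then show ?thesis
    by (simp add: y VoI_def rho_def inner_vector_matrix_mult flip: matrix_vector_mul_assoc)
qed

lemma voi_measurable [measurable]: "voi k \<in> borel_measurable borel"
  unfolding voi_eq[abs_def] by measurable

lemma voi_uminus: "voi k (- e) = voi k e"
  by (simp add: voi_eq cont_uminus)

text \<open>The Bellman minimum split for the two uses ahead: the bound with a free decision
  \<open>d\<close> serves every trigger, while \<open>V_eq\<close> records that the VoI rule attains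
  it, ties being resolved by transmitting.\<close>

lemma V_le: "V k e \<le> (if d then \<theta> k else 0) + cont k (if d then 0 else A k *v e)"
  by (simp add: V_rec[OF k])

lemma V_eq: "V k e = (if 0 \<le> voi k e then \<theta> k else 0) + cont k (if 0 \<le> voi k e then 0 else A k *v e)"
  by (simp add: V_rec[OF k] voi_eq)

end

end

section \<open>Realizations and their cost\<close>

lemma gen_alg_mono:
  assumes "I \<subseteq> J" "\<And>j. j \<in> J \<Longrightarrow> X j \<in> space M \<rightarrow> space N"
  shows "subalgebra (gen_alg M N X J) (gen_alg M N X I)"
proof (rule gen_alg_subalgebra)
  fix i assume "i \<in> I"
  then show "X i \<in> measurable (gen_alg M N X J) N"
    using assms by (intro gen_alg_component) auto
qed simp

lemma space_info_e [simp]: "space (info_e M x k) = space M"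
  by (simp add: info_e_def)

lemma space_info_c [simp]: "space (info_c M x \<delta> k) = space M"
  by (simp add: info_c_def)

lemma info_e_mono: "k \<le> l \<Longrightarrow> subalgebra (info_e M x l) (info_e M x k)"
  unfolding info_e_def by (intro gen_alg_mono) auto

lemma info_c_mono: "k \<le> l \<Longrightarrow> subalgebra (info_c M x \<delta> l) (info_c M x \<delta> k)"
  unfolding info_c_def by (intro gen_alg_mono) (auto simp: space_pair_measure)

lemma x_info_e: "t \<le> k \<Longrightarrow> x t \<in> borel_measurable (info_e M x k)"
  unfolding info_e_def by (intro gen_alg_component) auto

lemma obs_info_c: "t < k \<Longrightarrow> obs x \<delta> t \<in> measurable (info_c M x \<delta> k) (count_space UNIV \<Otimes>\<^sub>M borel)"
  unfolding info_c_def by (intro gen_alg_component) (auto simp: space_pair_measure)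

text \<open>The estimator reads \<open>x k\<close> only when it was transmitted, and exactly then it
  is the second component of \<open>obs\<close>; so the recursion factors through the controller's
  data.\<close>

lemma xhat_Suc_info_c:
  assumes "xhat A B m0 x \<delta> u k \<in> borel_measurable (info_c M x \<delta> k)"
    and "u k \<in> borel_measurable (info_c M x \<delta> k)"
  shows "xhat A B m0 x \<delta> u (Suc k) \<in> borel_measurable (info_c M x \<delta> (Suc k))"
proof -
  have [measurable]: "xhat A B m0 x \<delta> u k \<in> borel_measurable (info_c M x \<delta> (Suc k))"
    "u k \<in> borel_measurable (info_c M x \<delta> (Suc k))"
    using assms by (auto intro: measurable_from_subalg[OF info_c_mono[of k "Suc k"]])
  have [measurable]: "obs x \<delta> k \<in> measurable (info_c M x \<delta> (Suc k)) (count_space UNIV \<Otimes>\<^sub>M borel)"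
    by (intro obs_info_c) simp
  have "xhat A B m0 x \<delta> u (Suc k) = (\<lambda>\<omega>. A k *v xhat A B m0 x \<delta> u k \<omega> + B k *v u k \<omega>
      + (if fst (obs x \<delta> k \<omega>) then A k *v (snd (obs x \<delta> k \<omega>) - xhat A B m0 x \<delta> u k \<omega>) else 0))"
    by (auto simp: obs_def)
  also have "\<dots> \<in> borel_measurable (info_c M x \<delta> (Suc k))" by measurable
  finally show ?thesis .
qed

section \<open>Closed-loop trajectories and their cost decomposition\<close>

context event_trigger_model
begin

definition err :: "(nat \<Rightarrow> 'a \<Rightarrow> real^'n) \<Rightarrow> (nat \<Rightarrow> 'a \<Rightarrow> bool) \<Rightarrow> (nat \<Rightarrow> 'a \<Rightarrow> real^'m) \<Rightarrow> nat \<Rightarrow> 'a \<Rightarrow> real^'n" where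
  "err x \<delta> u k \<omega> = x k \<omega> - xhat A B m0 x \<delta> u k \<omega>"

text \<open>The price of a transmission at time \<open>k\<close> is paired with the error weight at
  time \<open>Suc k\<close>, the first error that the decision influences; this is the stage cost of
  the value function.\<close>

definition trigger_cost ::
    "(nat \<Rightarrow> 'a \<Rightarrow> real^'n) \<Rightarrow> (nat \<Rightarrow> 'a \<Rightarrow> bool) \<Rightarrow> (nat \<Rightarrow> 'a \<Rightarrow> real^'m) \<Rightarrow> nat \<Rightarrow> 'a \<Rightarrow> real" where
  "trigger_cost x \<delta> u k \<omega> = (if \<delta> k \<omega> then \<theta> k else 0)
      + err x \<delta> u (Suc k) \<omega> \<bullet> (\<Gamma> (Suc k) *v err x \<delta> u (Suc k) \<omega>)"

definition control_gap :: "(nat \<Rightarrow> 'a \<Rightarrow> real^'n) \<Rightarrow> (nat \<Rightarrow> 'a \<Rightarrow> real^'m) \<Rightarrow> nat \<Rightarrow> 'a \<Rightarrow> real" where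
  "control_gap x u k \<omega> = (u k \<omega> + L k *v x k \<omega>) \<bullet> (\<Lambda> k *v (u k \<omega> + L k *v x k \<omega>))"

lemma x0_square_integrable: "square_integrable M x0"
  using square_integrable_add[OF x0_sq square_integrable_const[of m0]] by simp

definition noise_cost :: real where
  "noise_cost = (\<integral>\<omega>. x0 \<omega> \<bullet> (S 0 *v x0 \<omega>) \<partial>M) + (\<Sum>k\<le>N. \<integral>\<omega>. w k \<omega> \<bullet> (S (Suc k) *v w k \<omega>) \<partial>M)"

context
  fixes x :: "nat \<Rightarrow> 'a \<Rightarrow> real^'n" and \<delta> :: "nat \<Rightarrow> 'a \<Rightarrow> bool" and u :: "nat \<Rightarrow> 'a \<Rightarrow> real^'m"
  assumes real: "realization M A B x0 w N x \<delta> u"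
begin

lemma x_0: "\<omega> \<in> space M \<Longrightarrow> x 0 \<omega> = x0 \<omega>"
  and x_Suc: "k \<le> N \<Longrightarrow> \<omega> \<in> space M \<Longrightarrow> x (Suc k) \<omega> = A k *v x k \<omega> + B k *v u k \<omega> + w k \<omega>"
  and \<delta>_info_e: "k \<le> N \<Longrightarrow> \<delta> k \<in> measurable (info_e M x k) (count_space UNIV)"
  and u_info_c: "k \<le> N \<Longrightarrow> u k \<in> borel_measurable (info_c M x \<delta> k)"
  using real by (auto simp: realization_def)

lemma err_0: "\<omega> \<in> space M \<Longrightarrow> err x \<delta> u 0 \<omega> = x0 \<omega> - m0"
  by (simp add: err_def x_0)

lemma err_Suc:
  assumes "k \<le> N" "\<omega> \<in> space M"
  shows "err x \<delta> u (Suc k) \<omega> = (if \<delta> k \<omega> then 0 else A k *v err x \<delta> u k \<omega>) + w k \<omega>"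
  using x_Suc[OF assms] by (simp add: err_def matrix_vector_mult_diff_distrib)

text \<open>Adaptedness of \<open>x\<close> is assumed only up to \<open>l\<close>, so that the
  lemma can be used inside the induction which proves it. The range \<open>k \<le> Suc l\<close>
  reflects the one-step delay: the information available at time \<open>Suc l\<close> stops at time
  \<open>l\<close>.\<close>

lemma subalgebra_info_c:
  assumes x: "\<And>t. t \<le> l \<Longrightarrow> x t \<in> borel_measurable (F t)" and "k \<le> Suc l" "l \<le> N"
  shows "subalgebra (F l) (info_c M x \<delta> k)"
  unfolding info_c_def
proof (rule gen_alg_subalgebra)
  fix t assume "t \<in> {..<k}"
  then have t: "t \<le> l" "t \<le> N" using assms by auto
  have "subalgebra (F t) (info_e M x t)"
    unfolding info_e_def
    using x t by (intro gen_alg_subalgebra) (auto intro: measurable_from_subalg[OF F_mono])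
  from measurable_from_subalg[OF this \<delta>_info_e[OF t(2)]]
  have [measurable]: "\<delta> t \<in> measurable (F l) (count_space UNIV)"
    by (rule measurable_from_subalg[OF F_mono[OF t(1)]])
  have [measurable]: "x t \<in> borel_measurable (F l)"
    by (rule measurable_from_subalg[OF F_mono[OF t(1)] x[OF t(1)]])
  show "obs x \<delta> t \<in> measurable (F l) (count_space UNIV \<Otimes>\<^sub>M borel)"
    unfolding obs_def[abs_def] by measurable
qed simp

text \<open>The loop from states to information to control to the next state is unwound in time:
  states up to \<open>k\<close> place the controller's information, hence \<open>u k\<close>, in
  \<open>F k\<close>, and \<open>w k\<close> is added in \<open>F (Suc k)\<close>. The whole past is
  carried along because the information depends on all of it.\<close>

lemma x_adapted_le: "k \<le> Suc N \<Longrightarrow> t \<le> k \<Longrightarrow> x t \<in> borel_measurable (F t)"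
proof (induction k arbitrary: t)
  case 0
  have "x 0 \<in> borel_measurable (F 0) \<longleftrightarrow> x0 \<in> borel_measurable (F 0)"
    by (rule measurable_cong) (simp add: x_0)
  then show ?case using 0 x0_F by simp
next
  case (Suc k)
  then have k: "k \<le> N" by simp
  have IH: "t \<le> k \<Longrightarrow> x t \<in> borel_measurable (F t)" for t using Suc by simp
  have "u k \<in> borel_measurable (F k)"
    using k by (intro measurable_from_subalg[OF subalgebra_info_c u_info_c]) (auto intro: IH)
  then have [measurable]: "u k \<in> borel_measurable (F (Suc k))" "x k \<in> borel_measurable (F (Suc k))"
    "w k \<in> borel_measurable (F (Suc k))"
    using IH[of k] by (auto intro: measurable_from_subalg[OF F_mono[of k "Suc k"]] w_F)
  have "x (Suc k) \<in> borel_measurable (F (Suc k))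
      \<longleftrightarrow> (\<lambda>\<omega>. A k *v x k \<omega> + B k *v u k \<omega> + w k \<omega>) \<in> borel_measurable (F (Suc k))"
    by (rule measurable_cong) (simp add: x_Suc k)
  moreover have "(\<lambda>\<omega>. A k *v x k \<omega> + B k *v u k \<omega> + w k \<omega>) \<in> borel_measurable (F (Suc k))"
    by measurable
  ultimately show ?case using Suc.prems IH by (cases "t = Suc k") auto
qed

lemma x_adapted: "k \<le> Suc N \<Longrightarrow> x k \<in> borel_measurable (F k)"
  by (rule x_adapted_le[of k k]) auto

lemma info_c_subalgebra_F: "k \<le> Suc l \<Longrightarrow> l \<le> N \<Longrightarrow> subalgebra (F l) (info_c M x \<delta> k)"
  by (rule subalgebra_info_c) (auto intro: x_adapted)

lemma info_c_subalgebra: "k \<le> Suc N \<Longrightarrow> subalgebra M (info_c M x \<delta> k)"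
  using info_c_subalgebra_F[of k N] subalgebra_F[of N] by (auto simp: subalgebra_def)

lemma \<delta>_adapted: "k \<le> N \<Longrightarrow> \<delta> k \<in> measurable (F k) (count_space UNIV)"
proof -
  assume k: "k \<le> N"
  have "subalgebra (F k) (info_e M x k)"
    unfolding info_e_def using k
    by (intro gen_alg_subalgebra) (auto intro!: measurable_from_subalg[OF F_mono x_adapted])
  from measurable_from_subalg[OF this \<delta>_info_e[OF k]] show ?thesis .
qed

lemma u_adapted: "k \<le> N \<Longrightarrow> u k \<in> borel_measurable (F k)"
  by (rule measurable_from_subalg[OF info_c_subalgebra_F u_info_c]) auto

lemma xhat_info_c: "k \<le> Suc N \<Longrightarrow> xhat A B m0 x \<delta> u k \<in> borel_measurable (info_c M x \<delta> k)"
proof (induction k)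
  case (Suc k)
  then show ?case by (intro xhat_Suc_info_c u_info_c) auto
qed simp

lemma err_adapted: "k \<le> N \<Longrightarrow> err x \<delta> u k \<in> borel_measurable (F k)"
proof -
  assume k: "k \<le> N"
  have [measurable]: "xhat A B m0 x \<delta> u k \<in> borel_measurable (F k)" "x k \<in> borel_measurable (F k)"
    using k by (auto intro!: measurable_from_subalg[OF info_c_subalgebra_F xhat_info_c] x_adapted)
  show ?thesis unfolding err_def by measurable
qed

lemma \<delta>_measurable: "k \<le> N \<Longrightarrow> \<delta> k \<in> measurable M (count_space UNIV)"
  by (rule measurable_from_subalg[OF subalgebra_F \<delta>_adapted]) auto

text \<open>The error recursion contains no control, so this holds for every realization, even when
  its cost is infinite.\<close>

lemma err_square_integrable: "k \<le> Suc N \<Longrightarrow> square_integrable M (err x \<delta> u k)"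
proof (induction k)
  case 0
  show ?case using x0_sq by (subst square_integrable_cong[OF err_0]) auto
next
  case (Suc k)
  then have k: "k \<le> N" by simp
  have "square_integrable M (\<lambda>\<omega>. (if \<delta> k \<omega> then 0 else A k *v err x \<delta> u k \<omega>) + w k \<omega>)"
    using Suc k
    by (intro square_integrable_add square_integrable_if square_integrable_const square_integrable_mult_vec
        w_sq \<delta>_measurable) auto
  then show ?case by (subst square_integrable_cong[OF err_Suc[OF k]]) auto
qed

text \<open>The tower property for one step, with the part of the next error known at time
  \<open>k\<close> frozen. Nonnegative integrals are used first because integrability of the
  \<open>cont\<close> term is not known beforehand; it then follows from that of the stage
  cost.\<close>

lemma expectation_stage:
  assumes k: "k \<le> N"
  shows "integrable M (\<lambda>\<omega>. cont k (if \<delta> k \<omega> then 0 else A k *v err x \<delta> u k \<omega>))"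
    and "(\<integral>\<omega>. cont k (if \<delta> k \<omega> then 0 else A k *v err x \<delta> u k \<omega>) \<partial>M)
       = (\<integral>\<omega>. stage k (err x \<delta> u (Suc k) \<omega>) \<partial>M)"
proof -
  define y where "y \<omega> = (if \<delta> k \<omega> then 0 else A k *v err x \<delta> u k \<omega>)" for \<omega>
  note [measurable] = \<delta>_adapted[OF k] err_adapted[OF k] stage_measurable[OF k] cont_measurable[OF k]
    square_integrable_measurable[OF w_sq[OF k]]
  have yF [measurable]: "y \<in> borel_measurable (F k)" unfolding y_def by measurable
  have [measurable]: "y \<in> borel_measurable M"
    using k by (intro measurable_from_subalg[OF subalgebra_F yF]) auto
  have int: "integrable M (\<lambda>\<omega>. stage k (err x \<delta> u (Suc k) \<omega>))"
    using k by (intro stage_integrable err_square_integrable) auto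
  have cont_nonneg: "0 \<le> cont k z" for z
    unfolding cont_def by (intro integral_nonneg_AE AE_I2 stage_nonneg k)
  have "(\<integral>\<^sup>+\<omega>. ennreal (stage k (err x \<delta> u (Suc k) \<omega>)) \<partial>M) = (\<integral>\<^sup>+\<omega>. ennreal (stage k (y \<omega> + w k \<omega>)) \<partial>M)"
    by (intro nn_integral_cong) (simp add: err_Suc[OF k] y_def)
  also have "\<dots> = (\<integral>\<^sup>+\<omega>. \<integral>\<^sup>+\<omega>'. ennreal (stage k (y \<omega> + w k \<omega>')) \<partial>M \<partial>M)"
    using nn_integral_indep_F[OF k, of "\<lambda>(\<omega>, v). ennreal (stage k (y \<omega> + v))"] by simp
  also have "\<dots> = (\<integral>\<^sup>+\<omega>. ennreal (cont k (y \<omega>)) \<partial>M)"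
    unfolding cont_def
    by (rule nn_integral_cong, rule nn_integral_eq_integral) (auto intro: stage_shift_integrable stage_nonneg k)
  finally have eq: "(\<integral>\<^sup>+\<omega>. ennreal (cont k (y \<omega>)) \<partial>M) = (\<integral>\<^sup>+\<omega>. ennreal (stage k (err x \<delta> u (Suc k) \<omega>)) \<partial>M)" ..
  also have "\<dots> = ennreal (\<integral>\<omega>. stage k (err x \<delta> u (Suc k) \<omega>) \<partial>M)"
    using int by (intro nn_integral_eq_integral) (auto intro: stage_nonneg k)
  finally have fin: "(\<integral>\<^sup>+\<omega>. ennreal (cont k (y \<omega>)) \<partial>M) = ennreal (\<integral>\<omega>. stage k (err x \<delta> u (Suc k) \<omega>) \<partial>M)" .
  show "integrable M (\<lambda>\<omega>. cont k (if \<delta> k \<omega> then 0 else A k *v err x \<delta> u k \<omega>))"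
    unfolding y_def[symmetric] using cont_nonneg by (intro integrableI_nonneg) (auto simp: fin)
  show "(\<integral>\<omega>. cont k (if \<delta> k \<omega> then 0 else A k *v err x \<delta> u k \<omega>) \<partial>M)
       = (\<integral>\<omega>. stage k (err x \<delta> u (Suc k) \<omega>) \<partial>M)"
    unfolding y_def[symmetric]
    using cont_nonneg stage_nonneg[OF k]
    by (subst integral_eq_nn_integral) (auto simp: fin enn2real_ennreal[OF integral_nonneg_AE[OF AE_I2]])
qed

lemma threshold_integrable: "k \<le> N \<Longrightarrow> integrable M (\<lambda>\<omega>. if \<delta> k \<omega> then \<theta> k else 0)"
  using \<delta>_measurable[of k] by (intro integrable_const_bound[where B="\<bar>\<theta> k\<bar>"]) auto

lemma expectation_trigger_cost:
  assumes k: "k \<le> N"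
  shows "(\<integral>\<omega>. (if \<delta> k \<omega> then \<theta> k else 0) + cont k (if \<delta> k \<omega> then 0 else A k *v err x \<delta> u k \<omega>) \<partial>M)
    = (\<integral>\<omega>. trigger_cost x \<delta> u k \<omega> \<partial>M) + (\<integral>\<omega>. V (Suc k) (err x \<delta> u (Suc k) \<omega>) \<partial>M)"
proof -
  have sq: "square_integrable M (err x \<delta> u (Suc k))" using k by (intro err_square_integrable) simp
  then have V: "integrable M (\<lambda>\<omega>. V (Suc k) (err x \<delta> u (Suc k) \<omega>))"
    using k by (intro V_integrable square_integrable_measurable) auto
  show ?thesis
    using expectation_stage[OF k] V integrable_quadratic_form[OF sq, of "\<Gamma> (Suc k)"] threshold_integrable[OF k]
    by (simp add: stage_def trigger_cost_def)
qed

text \<open>The verification argument: the Bellman inequality is integrated along an arbitrary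
  closed loop and accumulated backwards from the zero terminal value.\<close>

lemma V_le_trigger_cost:
  "k \<le> Suc N \<Longrightarrow> (\<integral>\<omega>. V k (err x \<delta> u k \<omega>) \<partial>M) \<le> (\<Sum>t\<in>{k..N}. \<integral>\<omega>. trigger_cost x \<delta> u t \<omega> \<partial>M)"
proof (induction rule: inc_induct)
  case base
  show ?case by (simp add: V_final)
next
  case (step k)
  then have k: "k \<le> N" by simp
  have "(\<integral>\<omega>. V k (err x \<delta> u k \<omega>) \<partial>M)
      \<le> (\<integral>\<omega>. (if \<delta> k \<omega> then \<theta> k else 0) + cont k (if \<delta> k \<omega> then 0 else A k *v err x \<delta> u k \<omega>) \<partial>M)"
    using k by (intro integral_mono V_integrable Bochner_Integration.integrable_add expectation_stage
        threshold_integrable V_le square_integrable_measurable err_square_integrable) auto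
  also have "\<dots> \<le> (\<integral>\<omega>. trigger_cost x \<delta> u k \<omega> \<partial>M) + (\<Sum>t\<in>{Suc k..N}. \<integral>\<omega>. trigger_cost x \<delta> u t \<omega> \<partial>M)"
    unfolding expectation_trigger_cost[OF k] using step.IH by simp
  also have "\<dots> = (\<Sum>t\<in>{k..N}. \<integral>\<omega>. trigger_cost x \<delta> u t \<omega> \<partial>M)"
    using k by (simp add: sum.atLeast_Suc_atMost)
  finally show ?case .
qed

lemma V_eq_trigger_cost:
  assumes trig: "trigger_rule M A B m0 w \<Gamma> \<theta> N x \<delta> u"
  shows "k \<le> Suc N \<Longrightarrow> (\<integral>\<omega>. V k (err x \<delta> u k \<omega>) \<partial>M) = (\<Sum>t\<in>{k..N}. \<integral>\<omega>. trigger_cost x \<delta> u t \<omega> \<partial>M)"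
proof (induction rule: inc_induct)
  case base
  show ?case by (simp add: V_final)
next
  case (step k)
  then have k: "k \<le> N" by simp
  have "(\<integral>\<omega>. V k (err x \<delta> u k \<omega>) \<partial>M)
      = (\<integral>\<omega>. (if \<delta> k \<omega> then \<theta> k else 0) + cont k (if \<delta> k \<omega> then 0 else A k *v err x \<delta> u k \<omega>) \<partial>M)"
  proof (rule Bochner_Integration.integral_cong[OF refl])
    fix \<omega> assume "\<omega> \<in> space M"
    then have "\<delta> k \<omega> = (0 \<le> voi k (err x \<delta> u k \<omega>))" using trig k by (simp add: trigger_rule_def err_def)
    then show "V k (err x \<delta> u k \<omega>) = (if \<delta> k \<omega> then \<theta> k else 0)
        + cont k (if \<delta> k \<omega> then 0 else A k *v err x \<delta> u k \<omega>)"
      by (simp only: V_eq[OF k])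
  qed
  also have "\<dots> = (\<integral>\<omega>. trigger_cost x \<delta> u k \<omega> \<partial>M) + (\<Sum>t\<in>{Suc k..N}. \<integral>\<omega>. trigger_cost x \<delta> u t \<omega> \<partial>M)"
    unfolding expectation_trigger_cost[OF k] using step.IH by simp
  also have "\<dots> = (\<Sum>t\<in>{k..N}. \<integral>\<omega>. trigger_cost x \<delta> u t \<omega> \<partial>M)"
    using k by (simp add: sum.atLeast_Suc_atMost)
  finally show ?case .
qed

text \<open>A pathwise identity. Completing the square at each step leaves the increments of
  \<open>x \<bullet> (S k *v x)\<close>, which telescope; the terminal cost is absorbed because
  \<open>S (Suc N) = Q (Suc N)\<close>.\<close>

lemma cost_integrand_eq:
  assumes \<omega>: "\<omega> \<in> space M"
  shows "x (Suc N) \<omega> \<bullet> (Q (Suc N) *v x (Suc N) \<omega>)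
      + (\<Sum>k\<le>N. x k \<omega> \<bullet> (Q k *v x k \<omega>) + u k \<omega> \<bullet> (R k *v u k \<omega>) + \<theta> k * (if \<delta> k \<omega> then 1 else 0))
    = x0 \<omega> \<bullet> (S 0 *v x0 \<omega>) + (\<Sum>k\<le>N. w k \<omega> \<bullet> (S (Suc k) *v w k \<omega>)
        + 2 * ((S (Suc k) *v (A k *v x k \<omega> + B k *v u k \<omega>)) \<bullet> w k \<omega>)
        + (u k \<omega> + L k *v x k \<omega>) \<bullet> (\<Lambda> k *v (u k \<omega> + L k *v x k \<omega>)) + (if \<delta> k \<omega> then \<theta> k else 0))"
    (is "_ = _ + (\<Sum>k\<le>N. ?r k)")
proof -
  define a where "a k = x k \<omega> \<bullet> (S k *v x k \<omega>)" for k
  have "x k \<omega> \<bullet> (Q k *v x k \<omega>) + u k \<omega> \<bullet> (R k *v u k \<omega>) + \<theta> k * (if \<delta> k \<omega> then 1 else 0)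
      = a k - a (Suc k) + ?r k" if k: "k \<le> N" for k
  proof -
    let ?v = "A k *v x k \<omega> + B k *v u k \<omega>"
    have "transpose (S (Suc k)) = S (Suc k)" using S_psd[of "Suc k"] k by (simp add: psd_def)
    then have "w k \<omega> \<bullet> (S (Suc k) *v ?v) = ?v \<bullet> (S (Suc k) *v w k \<omega>)" by (rule symmetric_inner_commute)
    then have "a (Suc k) = ?v \<bullet> (S (Suc k) *v ?v) + 2 * ((S (Suc k) *v ?v) \<bullet> w k \<omega>) + w k \<omega> \<bullet> (S (Suc k) *v w k \<omega>)"
      unfolding a_def x_Suc[OF k \<omega>]
      by (simp only: matrix_vector_right_distrib[of "S (Suc k)" ?v] inner_add_left[of ?v] inner_add_right
          inner_commute[of "S (Suc k) *v ?v"])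
    then show ?thesis
      using complete_square[OF k, of "x k \<omega>" "u k \<omega>"] by (simp add: a_def)
  qed
  then have "(\<Sum>k\<le>N. x k \<omega> \<bullet> (Q k *v x k \<omega>) + u k \<omega> \<bullet> (R k *v u k \<omega>) + \<theta> k * (if \<delta> k \<omega> then 1 else 0))
      = (\<Sum>k\<le>N. a k - a (Suc k)) + (\<Sum>k\<le>N. ?r k)"
    by (simp add: sum.distrib[symmetric])
  also have "(\<Sum>k\<le>N. a k - a (Suc k)) = a 0 - a (Suc N)" by (rule sum_telescope)
  finally show ?thesis by (simp add: a_def S_final x_0 \<omega>)
qed

text \<open>The terms linear in \<open>w k\<close> have zero mean, their coefficients being
  \<open>F k\<close>-measurable. Square integrability permits splitting the integral; it is asked
  for only up to time \<open>N\<close> because the terminal state has disappeared from the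
  telescoped form.\<close>

lemma cost_eq:
  assumes x: "\<And>k. k \<le> N \<Longrightarrow> square_integrable M (x k)" and u: "\<And>k. k \<le> N \<Longrightarrow> square_integrable M (u k)"
  shows "cost M Q R \<theta> N x \<delta> u = ennreal (noise_cost
      + (\<Sum>k\<le>N. (\<integral>\<omega>. control_gap x u k \<omega> \<partial>M) + (\<integral>\<omega>. (if \<delta> k \<omega> then \<theta> k else 0) \<partial>M)))"
proof -
  let ?I = "\<lambda>\<omega>. x (Suc N) \<omega> \<bullet> (Q (Suc N) *v x (Suc N) \<omega>)
      + (\<Sum>k\<le>N. x k \<omega> \<bullet> (Q k *v x k \<omega>) + u k \<omega> \<bullet> (R k *v u k \<omega>) + \<theta> k * (if \<delta> k \<omega> then 1 else 0))"
  let ?v = "\<lambda>k \<omega>. S (Suc k) *v (A k *v x k \<omega> + B k *v u k \<omega>)"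
  let ?J = "\<lambda>\<omega>. x0 \<omega> \<bullet> (S 0 *v x0 \<omega>) + (\<Sum>k\<le>N. w k \<omega> \<bullet> (S (Suc k) *v w k \<omega>)
        + 2 * (?v k \<omega> \<bullet> w k \<omega>) + control_gap x u k \<omega> + (if \<delta> k \<omega> then \<theta> k else 0))"
  have IJ: "?I \<omega> = ?J \<omega>" if "\<omega> \<in> space M" for \<omega>
    using cost_integrand_eq[OF that] by (simp add: control_gap_def)
  have v: "square_integrable M (?v k)" if "k \<le> N" for k
    by (intro square_integrable_mult_vec square_integrable_add x u that)
  have gap: "integrable M (control_gap x u k)" if "k \<le> N" for k
    unfolding control_gap_def[abs_def]
    by (intro integrable_quadratic_form square_integrable_mult_vec square_integrable_add x u that)
  have i0: "integrable M (\<lambda>\<omega>. x0 \<omega> \<bullet> (S 0 *v x0 \<omega>))"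
    by (intro integrable_quadratic_form x0_square_integrable)
  have iw: "integrable M (\<lambda>\<omega>. w k \<omega> \<bullet> (S (Suc k) *v w k \<omega>))" if "k \<le> N" for k
    by (intro integrable_quadratic_form w_sq that)
  have iv: "integrable M (\<lambda>\<omega>. ?v k \<omega> \<bullet> w k \<omega>)" if "k \<le> N" for k
    by (intro integrable_inner_square_integrable v w_sq that)
  have zero: "(\<integral>\<omega>. ?v k \<omega> \<bullet> w k \<omega> \<partial>M) = 0" if k: "k \<le> N" for k
  proof (rule expectation_inner_noise[OF k _ v[OF k]])
    note [measurable] = x_adapted[OF le_SucI[OF k]] u_adapted[OF k]
    show "?v k \<in> borel_measurable (F k)" by measurable
  qed
  have intJ: "integrable M ?J"
    by (intro Bochner_Integration.integrable_add Bochner_Integration.integrable_sum i0 iw gap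
        integrable_mult_right iv threshold_integrable) auto
  have intI: "integrable M ?I"
    by (rule Bochner_Integration.integrable_cong[THEN iffD1, OF refl _ intJ]) (rule IJ[symmetric])
  have nonneg: "0 \<le> ?I \<omega>" for \<omega>
    using theta_nonneg by (intro add_nonneg_nonneg sum_nonneg Q_nonneg R_nonneg mult_nonneg_nonneg) auto
  have "cost M Q R \<theta> N x \<delta> u = ennreal (\<integral>\<omega>. ?I \<omega> \<partial>M)"
    unfolding cost_def using intI nonneg by (intro nn_integral_eq_integral) auto
  also have "(\<integral>\<omega>. ?I \<omega> \<partial>M) = (\<integral>\<omega>. ?J \<omega> \<partial>M)"
    by (rule Bochner_Integration.integral_cong[OF refl IJ])
  also have "\<dots> = (\<integral>\<omega>. x0 \<omega> \<bullet> (S 0 *v x0 \<omega>) \<partial>M) + (\<Sum>k\<le>N. \<integral>\<omega>. w k \<omega> \<bullet> (S (Suc k) *v w k \<omega>)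
        + 2 * (?v k \<omega> \<bullet> w k \<omega>) + control_gap x u k \<omega> + (if \<delta> k \<omega> then \<theta> k else 0) \<partial>M)"
    by (subst Bochner_Integration.integral_add)
       (auto intro!: Bochner_Integration.integral_sum Bochner_Integration.integrable_add
         Bochner_Integration.integrable_sum i0 iw gap integrable_mult_right iv threshold_integrable)
  also have "(\<Sum>k\<le>N. \<integral>\<omega>. w k \<omega> \<bullet> (S (Suc k) *v w k \<omega>)
        + 2 * (?v k \<omega> \<bullet> w k \<omega>) + control_gap x u k \<omega> + (if \<delta> k \<omega> then \<theta> k else 0) \<partial>M)
      = (\<Sum>k\<le>N. (\<integral>\<omega>. w k \<omega> \<bullet> (S (Suc k) *v w k \<omega>) \<partial>M)
        + ((\<integral>\<omega>. control_gap x u k \<omega> \<partial>M) + (\<integral>\<omega>. (if \<delta> k \<omega> then \<theta> k else 0) \<partial>M)))"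
  proof (rule sum.cong[OF refl])
    fix k assume "k \<in> {..N}"
    then have k: "k \<le> N" by simp
    have i2: "integrable M (\<lambda>\<omega>. 2 * (?v k \<omega> \<bullet> w k \<omega>))" by (intro integrable_mult_right iv k)
    have z2: "(\<integral>\<omega>. 2 * (?v k \<omega> \<bullet> w k \<omega>) \<partial>M) = 0" by (simp only: integral_mult_right_zero zero[OF k])
    show "(\<integral>\<omega>. w k \<omega> \<bullet> (S (Suc k) *v w k \<omega>)
        + 2 * (?v k \<omega> \<bullet> w k \<omega>) + control_gap x u k \<omega> + (if \<delta> k \<omega> then \<theta> k else 0) \<partial>M)
      = (\<integral>\<omega>. w k \<omega> \<bullet> (S (Suc k) *v w k \<omega>) \<partial>M)
        + ((\<integral>\<omega>. control_gap x u k \<omega> \<partial>M) + (\<integral>\<omega>. (if \<delta> k \<omega> then \<theta> k else 0) \<partial>M))"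
      using iw[OF k] i2 gap[OF k] threshold_integrable[OF k] z2
      by (simp only: Bochner_Integration.integral_add Bochner_Integration.integrable_add)
  qed
  finally show ?thesis by (simp add: noise_cost_def sum.distrib add.assoc)
qed

end

end

section \<open>Equilibrium\<close>

lemma sets_info_c_0: "D \<in> sets (info_c M x \<delta> 0) \<Longrightarrow> D = {} \<or> D = space M"
  unfolding info_c_def by (subst (asm) sets_gen_alg) (auto simp: space_pair_measure restrict_def split: if_splits)

text \<open>Under silence the newest observation is the constant \<open>(False, 0)\<close>.
  Substituting this constant in the defining event produces an event of the older information that
  agrees with the original one wherever nothing is sent.\<close>

lemma info_c_Suc_no_transmission:
  assumes "D \<in> sets (info_c M x \<delta> (Suc k))"
  obtains D' where "D' \<in> sets (info_c M x \<delta> k)"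
    "\<And>\<omega>. \<omega> \<in> space M \<Longrightarrow> \<not> \<delta> k \<omega> \<Longrightarrow> \<omega> \<in> D \<longleftrightarrow> \<omega> \<in> D'"
proof -
  let ?P = "Pi\<^sub>M {..<Suc k} (\<lambda>_. count_space UNIV \<Otimes>\<^sub>M borel) :: (nat \<Rightarrow> bool \<times> (real^'b)) measure"
  define X where "X \<omega> = (\<lambda>i\<in>{..<Suc k}. obs x \<delta> i \<omega>)" for \<omega>
  define X' where "X' \<omega> = (\<lambda>i\<in>{..<Suc k}. if i = k then (False, 0) else obs x \<delta> i \<omega>)" for \<omega>
  have "sets (info_c M x \<delta> (Suc k)) = {X -` E \<inter> space M | E. E \<in> sets ?P}"
    unfolding info_c_def X_def by (rule sets_gen_alg) (simp add: space_pair_measure)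
  then obtain E where E: "D = X -` E \<inter> space M" "E \<in> sets ?P"
    using assms by blast
  have "X' \<in> measurable (info_c M x \<delta> k) ?P"
    unfolding X'_def
  proof (rule measurable_restrict)
    fix i assume "i \<in> {..<Suc k}"
    then show "(\<lambda>\<omega>. if i = k then (False, 0) else obs x \<delta> i \<omega>)
        \<in> measurable (info_c M x \<delta> k) (count_space UNIV \<Otimes>\<^sub>M borel)"
      by (cases "i = k") (auto intro: obs_info_c simp: space_pair_measure)
  qed
  from measurable_sets[OF this E(2)] have "X' -` E \<inter> space M \<in> sets (info_c M x \<delta> k)" by simp
  moreover have "X' \<omega> = X \<omega>" if "\<not> \<delta> k \<omega>" for \<omega>
    using that by (auto simp: X_def X'_def obs_def restrict_def)
  ultimately show thesis
    by (intro that[of "X' -` E \<inter> space M"]) (auto simp: E(1))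
qed

context event_trigger_model
begin

context
  fixes x :: "nat \<Rightarrow> 'a \<Rightarrow> real^'n" and \<delta> :: "nat \<Rightarrow> 'a \<Rightarrow> bool" and u :: "nat \<Rightarrow> 'a \<Rightarrow> real^'m"
  assumes real: "realization M A B x0 w N x \<delta> u" and trig: "trigger_rule M A B m0 w \<Gamma> \<theta> N x \<delta> u"
begin

lemma \<delta>_eq_voi: "k \<le> N \<Longrightarrow> \<omega> \<in> space M \<Longrightarrow> \<delta> k \<omega> \<longleftrightarrow> 0 \<le> voi k (err x \<delta> u k \<omega>)"
  using trig by (simp add: trigger_rule_def err_def)

text \<open>The conditional law of the error given the controller's information is symmetric: a
  transmission resets the error to fresh symmetric noise, and silence is an even event of the error.\<close>
lemma err_conditionally_symmetric:
  assumes "k \<le> N" "D \<in> sets (info_c M x \<delta> k)" "\<phi> \<in> borel_measurable borel"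
  shows "(\<integral>\<^sup>+\<omega>. indicator D \<omega> * \<phi> (err x \<delta> u k \<omega>) \<partial>M) = (\<integral>\<^sup>+\<omega>. indicator D \<omega> * \<phi> (- err x \<delta> u k \<omega>) \<partial>M)"
  using assms
proof (induction k arbitrary: D \<phi>)
  case 0
  have [measurable]: "\<phi> \<in> borel_measurable borel" "x0 \<in> borel_measurable M"
    using 0 by (auto intro: x0_measurable)
  have "(\<integral>\<^sup>+\<omega>. \<phi> (err x \<delta> u 0 \<omega>) \<partial>M) = (\<integral>\<^sup>+v. \<phi> v \<partial>distr M borel (\<lambda>\<omega>. x0 \<omega> - m0))"
    by (subst nn_integral_distr) (auto intro!: nn_integral_cong simp: err_0[OF real])
  also have "\<dots> = (\<integral>\<^sup>+\<omega>. \<phi> (- err x \<delta> u 0 \<omega>) \<partial>M)"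
    unfolding x0_sym by (subst nn_integral_distr) (auto intro!: nn_integral_cong simp: err_0[OF real])
  finally have "(\<integral>\<^sup>+\<omega>. \<phi> (err x \<delta> u 0 \<omega>) \<partial>M) = (\<integral>\<^sup>+\<omega>. \<phi> (- err x \<delta> u 0 \<omega>) \<partial>M)" .
  moreover have "(\<integral>\<^sup>+\<omega>. indicator (space M) \<omega> * f \<omega> \<partial>M) = (\<integral>\<^sup>+\<omega>. f \<omega> \<partial>M)" for f
    by (rule nn_integral_cong) simp
  ultimately show ?case
    using sets_info_c_0[OF 0(2)] by auto
next
  case (Suc k)
  then have k: "k \<le> N" by simp
  have [measurable]: "\<phi> \<in> borel_measurable borel" by fact
  note [measurable] = \<delta>_adapted[OF real k] err_adapted[OF real k] voi_measurable[OF k] w_measurable[OF k]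
  \<comment> \<open>The one-step delay matters here: the controller's information at time
    \<open>Suc k\<close> lies in \<open>F k\<close> and is therefore independent of
    \<open>w k\<close>.\<close>
  have DF [measurable]: "D \<in> sets (F k)"
    using info_c_subalgebra_F[OF real, of "Suc k" k] k Suc.prems(2) by (auto simp: subalgebra_def)
  obtain D' where D': "D' \<in> sets (info_c M x \<delta> k)"
    "\<And>\<omega>. \<omega> \<in> space M \<Longrightarrow> \<not> \<delta> k \<omega> \<Longrightarrow> \<omega> \<in> D \<longleftrightarrow> \<omega> \<in> D'"
    using info_c_Suc_no_transmission[OF Suc.prems(2)] by blast
  have D'F: "D' \<in> sets (F k)"
    using info_c_subalgebra_F[OF real, of k k] k D'(1) by (auto simp: subalgebra_def)
  have sub: "sets (F k) \<subseteq> sets M" using subalgebra_F[of k] k by (auto simp: subalgebra_def)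
  have [measurable]: "D \<in> sets M" "D' \<in> sets M" "\<delta> k \<in> measurable M (count_space UNIV)"
    "err x \<delta> u k \<in> borel_measurable M"
    using DF D'F sub k
    by (auto intro: \<delta>_measurable[OF real] square_integrable_measurable[OF err_square_integrable[OF real]])
  define y where "y \<omega> = (if \<delta> k \<omega> then 0 else A k *v err x \<delta> u k \<omega>)" for \<omega>
  have [measurable]: "y \<in> borel_measurable (F k)" unfolding y_def by measurable
  define \<Phi> where "\<Phi> z = (\<integral>\<^sup>+\<omega>'. \<phi> (z + w k \<omega>') \<partial>M)" for z
  have [measurable]: "\<Phi> \<in> borel_measurable borel" unfolding \<Phi>_def by measurable
  have step: "(\<integral>\<^sup>+\<omega>. indicator D \<omega> * \<psi> (err x \<delta> u (Suc k) \<omega>) \<partial>M)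
      = (\<integral>\<^sup>+\<omega>. indicator D \<omega> * (\<integral>\<^sup>+\<omega>'. \<psi> (y \<omega> + w k \<omega>') \<partial>M) \<partial>M)"
    if [measurable]: "\<psi> \<in> borel_measurable borel" for \<psi> :: "real^'n \<Rightarrow> ennreal"
  proof -
    have "(\<integral>\<^sup>+\<omega>. indicator D \<omega> * \<psi> (err x \<delta> u (Suc k) \<omega>) \<partial>M)
        = (\<integral>\<^sup>+\<omega>. indicator D \<omega> * \<psi> (y \<omega> + w k \<omega>) \<partial>M)"
      by (intro nn_integral_cong) (simp add: err_Suc[OF real k] y_def)
    also have "\<dots> = (\<integral>\<^sup>+\<omega>. \<integral>\<^sup>+\<omega>'. indicator D \<omega> * \<psi> (y \<omega> + w k \<omega>') \<partial>M \<partial>M)"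
      using nn_integral_indep_F[OF k, of "\<lambda>(\<omega>, v). indicator D \<omega> * \<psi> (y \<omega> + v)"] by simp
    also have "\<dots> = (\<integral>\<^sup>+\<omega>. indicator D \<omega> * (\<integral>\<^sup>+\<omega>'. \<psi> (y \<omega> + w k \<omega>') \<partial>M) \<partial>M)"
      by (rule nn_integral_cong, rule nn_integral_cmult) measurable
    finally show ?thesis .
  qed
  have flip: "(\<integral>\<^sup>+\<omega>'. \<phi> (- (z + w k \<omega>')) \<partial>M) = \<Phi> (- z)" for z
    using w_symmetric_nn_integral[OF k, of "\<lambda>v. \<phi> (- z + v)"] by (simp add: \<Phi>_def)
  \<comment> \<open>Silence is moved into the test function, as an even event of the error, so that
    the remaining event \<open>D'\<close> is one to which the induction hypothesis applies.\<close>
  define \<phi>' where "\<phi>' e = (if 0 \<le> voi k e then 0 else \<Phi> (A k *v e))" for e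
  have [measurable]: "\<phi>' \<in> borel_measurable borel" unfolding \<phi>'_def by measurable
  \<comment> \<open>Both signs are treated at once: after a transmission \<open>y = 0\<close> and
    the sign is immaterial; under silence, \<open>voi_uminus\<close> makes the sign flip compatible
    with the test function.\<close>
  have split: "(\<integral>\<^sup>+\<omega>. indicator D \<omega> * \<Phi> (\<sigma> *\<^sub>R y \<omega>) \<partial>M)
      = (\<integral>\<^sup>+\<omega>. indicator D \<omega> * (if \<delta> k \<omega> then \<Phi> 0 else 0) \<partial>M)
        + (\<integral>\<^sup>+\<omega>. indicator D' \<omega> * \<phi>' (\<sigma> *\<^sub>R err x \<delta> u k \<omega>) \<partial>M)"
    if \<sigma>: "\<sigma> = 1 \<or> \<sigma> = - 1" for \<sigma> :: real
  proof -
    have "(\<integral>\<^sup>+\<omega>. indicator D \<omega> * \<Phi> (\<sigma> *\<^sub>R y \<omega>) \<partial>M)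
      = (\<integral>\<^sup>+\<omega>. indicator D \<omega> * (if \<delta> k \<omega> then \<Phi> 0 else 0)
        + indicator D' \<omega> * \<phi>' (\<sigma> *\<^sub>R err x \<delta> u k \<omega>) \<partial>M)"
    proof (rule nn_integral_cong)
      fix \<omega> assume \<omega>: "\<omega> \<in> space M"
      show "indicator D \<omega> * \<Phi> (\<sigma> *\<^sub>R y \<omega>) = indicator D \<omega> * (if \<delta> k \<omega> then \<Phi> 0 else 0)
        + indicator D' \<omega> * \<phi>' (\<sigma> *\<^sub>R err x \<delta> u k \<omega>)"
        using D'(2)[OF \<omega>] \<delta>_eq_voi[OF k \<omega>] \<sigma>
        by (cases "\<delta> k \<omega>") (auto simp: \<phi>'_def y_def voi_uminus[OF k] indicator_def)
    qed
    also have "\<dots> = (\<integral>\<^sup>+\<omega>. indicator D \<omega> * (if \<delta> k \<omega> then \<Phi> 0 else 0) \<partial>M)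
        + (\<integral>\<^sup>+\<omega>. indicator D' \<omega> * \<phi>' (\<sigma> *\<^sub>R err x \<delta> u k \<omega>) \<partial>M)"
      by (rule nn_integral_add) measurable
    finally show ?thesis .
  qed
  have "(\<integral>\<^sup>+\<omega>. indicator D \<omega> * \<phi> (err x \<delta> u (Suc k) \<omega>) \<partial>M) = (\<integral>\<^sup>+\<omega>. indicator D \<omega> * \<Phi> (y \<omega>) \<partial>M)"
    by (simp only: step[OF \<open>\<phi> \<in> borel_measurable borel\<close>] \<Phi>_def)
  also have "\<dots> = (\<integral>\<^sup>+\<omega>. indicator D \<omega> * \<Phi> (- y \<omega>) \<partial>M)"
    using split[of 1] split[of "- 1"] Suc.IH[OF k D'(1), of \<phi>'] by simp
  also have "\<dots> = (\<integral>\<^sup>+\<omega>. indicator D \<omega> * \<phi> (- err x \<delta> u (Suc k) \<omega>) \<partial>M)"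
    using step[of "\<lambda>v. \<phi> (- v)"] by (simp only: flip) simp
  finally show ?case .
qed

text \<open>Symmetry on each event of the controller's information equates the integrals of the
  positive and negative parts of an error coordinate, so its conditional expectation vanishes; the
  coordinates of \<open>z\<close> are then pulled out of it.\<close>

lemma expectation_inner_err:
  assumes k: "k \<le> N" and z: "z \<in> borel_measurable (info_c M x \<delta> k)" "square_integrable M z"
  shows "(\<integral>\<omega>. z \<omega> \<bullet> err x \<delta> u k \<omega> \<partial>M) = 0"
proof -
  let ?G = "info_c M x \<delta> k" and ?e = "err x \<delta> u k"
  have sub: "subalgebra M ?G" using k by (intro info_c_subalgebra[OF real]) simp
  interpret G: finite_measure_subalgebra M ?G by unfold_locales (rule sub)
  have e_sq: "square_integrable M ?e" using k by (intro err_square_integrable[OF real]) simp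
  note [measurable] = square_integrable_measurable[OF e_sq]
  have comp: "integrable M (\<lambda>\<omega>. z \<omega> $ i * ?e \<omega> $ i)" "(\<integral>\<omega>. z \<omega> $ i * ?e \<omega> $ i \<partial>M) = 0" for i
  proof -
    have ei: "integrable M (\<lambda>\<omega>. ?e \<omega> $ i)"
      using integrable_inner_const[OF e_sq, of "axis i 1"] by (simp add: inner_axis')
    have "AE \<omega> in M. real_cond_exp M ?G (\<lambda>\<omega>. ?e \<omega> $ i) \<omega> = 0"
    proof (rule G.real_cond_exp_charact)
      fix D assume D: "D \<in> sets ?G"
      then have [measurable]: "D \<in> sets M" using sub by (auto simp: subalgebra_def)
      have i: "integrable M (\<lambda>\<omega>. indicator D \<omega> * ?e \<omega> $ i)"
        using integrable_mult_indicator[OF _ ei, of D] by simp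
      have "(\<integral>\<^sup>+\<omega>. ennreal (indicator D \<omega> * ?e \<omega> $ i) \<partial>M) = (\<integral>\<^sup>+\<omega>. indicator D \<omega> * ennreal (?e \<omega> $ i) \<partial>M)"
        by (intro nn_integral_cong) (simp add: indicator_def)
      also have "\<dots> = (\<integral>\<^sup>+\<omega>. indicator D \<omega> * ennreal ((- ?e \<omega>) $ i) \<partial>M)"
        by (rule err_conditionally_symmetric[OF k D, of "\<lambda>v. ennreal (v $ i)"]) measurable
      also have "\<dots> = (\<integral>\<^sup>+\<omega>. ennreal (- (indicator D \<omega> * ?e \<omega> $ i)) \<partial>M)"
        by (intro nn_integral_cong) (simp add: indicator_def)
      finally show "(\<integral>\<omega>\<in>D. ?e \<omega> $ i \<partial>M) = (\<integral>\<omega>\<in>D. 0 \<partial>M)"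
        using i by (simp add: set_lebesgue_integral_def real_lebesgue_integral_def)
    qed (use ei in auto)
    then have ae: "AE \<omega> in M. z \<omega> $ i * real_cond_exp M ?G (\<lambda>\<omega>. ?e \<omega> $ i) \<omega> = 0" by auto
    \<comment> \<open>The product of two coordinates is written as an inner product of
      square-integrable vectors by placing coordinate \<open>i\<close> of \<open>z\<close> back on
      its axis.\<close>
    have "integrable M (\<lambda>\<omega>. (z \<omega> $ i *\<^sub>R axis i 1) \<bullet> ?e \<omega>)"
    proof (rule integrable_inner_square_integrable[OF _ e_sq])
      have "bounded_linear (\<lambda>v::real^'n. v $ i *\<^sub>R axis i (1::real))"
        by (intro bounded_linear_scaleR_left[THEN bounded_linear_compose] bounded_linear_vec_nth)
      from square_integrable_bounded_linear[OF this z(2)]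
      show "square_integrable M (\<lambda>\<omega>. z \<omega> $ i *\<^sub>R axis i (1::real))" .
    qed
    then show int: "integrable M (\<lambda>\<omega>. z \<omega> $ i * ?e \<omega> $ i)" by (simp add: inner_axis')
    have "(\<integral>\<omega>. z \<omega> $ i * ?e \<omega> $ i \<partial>M) = (\<integral>\<omega>. z \<omega> $ i * real_cond_exp M ?G (\<lambda>\<omega>. ?e \<omega> $ i) \<omega> \<partial>M)"
      by (intro G.real_cond_exp_intg(2)[symmetric] int borel_measurable_vec_nth[OF z(1)] borel_measurable_integrable[OF ei])
    also have "\<dots> = 0" by (rule integral_eq_zero_AE[OF ae])
    finally show "(\<integral>\<omega>. z \<omega> $ i * ?e \<omega> $ i \<partial>M) = 0" .
  qed
  then show ?thesis by (simp add: inner_vec_def)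
qed

text \<open>\<open>z = u k + L k xhat\<close> is known to the controller, so its cross term with
  \<open>L k e\<close> averages to zero; dropping the nonnegative form in \<open>z\<close> leaves
  the loss of certainty equivalence as a lower bound.\<close>

lemma control_gap_ge:
  assumes k: "k \<le> N" and x: "square_integrable M (x k)" and u: "square_integrable M (u k)"
  shows "(\<integral>\<omega>. err x \<delta> u k \<omega> \<bullet> (\<Gamma> k *v err x \<delta> u k \<omega>) \<partial>M) \<le> (\<integral>\<omega>. control_gap x u k \<omega> \<partial>M)"
proof -
  let ?e = "err x \<delta> u k" and ?xh = "xhat A B m0 x \<delta> u k"
  define z where "z \<omega> = u k \<omega> + L k *v ?xh \<omega>" for \<omega>
  have e_sq: "square_integrable M ?e" using k by (intro err_square_integrable[OF real]) simp
  have "?xh = (\<lambda>\<omega>. x k \<omega> - ?e \<omega>)" by (simp add: err_def)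
  then have "square_integrable M ?xh" using x e_sq by (simp only: square_integrable_diff)
  then have z_sq: "square_integrable M z"
    unfolding z_def by (intro square_integrable_add square_integrable_mult_vec u)
  note [measurable] = u_info_c[OF real k] xhat_info_c[OF real le_SucI[OF k]]
  have z_meas [measurable]: "z \<in> borel_measurable (info_c M x \<delta> k)" unfolding z_def by measurable
  \<comment> \<open>Transposition moves both matrices onto the factor known to the controller, the
    form in which orthogonality to the error was proved.\<close>
  let ?a = "\<lambda>\<omega>. transpose (L k) *v (transpose (\<Lambda> k) *v z \<omega>)"
  have a_sq: "square_integrable M ?a" by (intro square_integrable_mult_vec z_sq)
  have "(\<integral>\<omega>. ?a \<omega> \<bullet> ?e \<omega> \<partial>M) = 0"
    by (rule expectation_inner_err[OF k _ a_sq]) measurable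
  then have zero: "(\<integral>\<omega>. z \<omega> \<bullet> (\<Lambda> k *v (L k *v ?e \<omega>)) \<partial>M) = 0"
    by (simp add: dot_lmul_matrix)
  have i: "integrable M (\<lambda>\<omega>. z \<omega> \<bullet> (\<Lambda> k *v (L k *v ?e \<omega>)))" "integrable M (\<lambda>\<omega>. ?e \<omega> \<bullet> (\<Gamma> k *v ?e \<omega>))"
    by (intro integrable_inner_square_integrable square_integrable_mult_vec z_sq e_sq)+
  have gap: "integrable M (control_gap x u k)"
    unfolding control_gap_def[abs_def]
    by (intro integrable_quadratic_form square_integrable_mult_vec square_integrable_add x u)
  have "(\<integral>\<omega>. ?e \<omega> \<bullet> (\<Gamma> k *v ?e \<omega>) \<partial>M)
      = (\<integral>\<omega>. ?e \<omega> \<bullet> (\<Gamma> k *v ?e \<omega>) + 2 * (z \<omega> \<bullet> (\<Lambda> k *v (L k *v ?e \<omega>))) \<partial>M)"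
    using i zero by simp
  also have "\<dots> \<le> (\<integral>\<omega>. control_gap x u k \<omega> \<partial>M)"
  proof (rule integral_mono)
    fix \<omega>
    let ?l = "L k *v ?e \<omega>"
    have "psd (\<Lambda> k)" by (rule pd_imp_psd[OF \<Lambda>_pd[OF k]])
    then have "0 \<le> z \<omega> \<bullet> (\<Lambda> k *v z \<omega>)" "?l \<bullet> (\<Lambda> k *v z \<omega>) = z \<omega> \<bullet> (\<Lambda> k *v ?l)"
      by (auto simp: psd_def intro: symmetric_inner_commute)
    moreover have "u k \<omega> + L k *v x k \<omega> = z \<omega> + ?l"
      by (simp add: z_def err_def matrix_vector_mult_diff_distrib)
    ultimately show "?e \<omega> \<bullet> (\<Gamma> k *v ?e \<omega>) + 2 * (z \<omega> \<bullet> (\<Lambda> k *v ?l)) \<le> control_gap x u k \<omega>"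
      by (simp add: control_gap_def inner_\<Gamma>[OF k] matrix_vector_right_distrib inner_add_left inner_add_right)
  qed (use i gap in auto)
  finally show ?thesis .
qed

text \<open>Positive definiteness of \<open>R\<close> bounds the controls by the cost. As
  \<open>Q\<close> is only semidefinite, the states cannot be bounded the same way and are recovered
  through the dynamics.\<close>

lemma square_integrable_of_finite_cost:
  assumes "cost M Q R \<theta> N x \<delta> u < \<infinity>"
  shows "k \<le> N \<Longrightarrow> square_integrable M (u k)" "k \<le> N \<Longrightarrow> square_integrable M (x k)"
proof -
  show u: "square_integrable M (u k)" if k: "k \<le> N" for k
  proof -
    obtain r where r: "r > 0" "\<And>v. r * (norm v)\<^sup>2 \<le> v \<bullet> (R k *v v)" using pd_lower_bound[OF R_pd[OF k]] by blast
    have [measurable]: "u k \<in> borel_measurable M"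
      using k by (intro measurable_from_subalg[OF subalgebra_F u_adapted[OF real]]) auto
    have "(\<integral>\<^sup>+\<omega>. ennreal (r * (norm (u k \<omega>))\<^sup>2) \<partial>M) \<le> cost M Q R \<theta> N x \<delta> u"
      unfolding cost_def
    proof (intro nn_integral_mono ennreal_leI)
      fix \<omega>
      let ?s = "\<lambda>k. x k \<omega> \<bullet> (Q k *v x k \<omega>) + u k \<omega> \<bullet> (R k *v u k \<omega>) + \<theta> k * (if \<delta> k \<omega> then 1 else 0)"
      have s: "0 \<le> ?s j" if "j \<le> N" for j
        using that theta_nonneg[of j] by (intro add_nonneg_nonneg Q_nonneg R_nonneg mult_nonneg_nonneg) auto
      have "r * (norm (u k \<omega>))\<^sup>2 \<le> u k \<omega> \<bullet> (R k *v u k \<omega>)" by (rule r(2))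
      also have "\<dots> \<le> ?s k"
        using Q_nonneg[of k "x k \<omega>"] k theta_nonneg[of k] by auto
      also have "\<dots> \<le> (\<Sum>j\<le>N. ?s j)"
        using k s by (intro member_le_sum) auto
      also have "\<dots> \<le> x (Suc N) \<omega> \<bullet> (Q (Suc N) *v x (Suc N) \<omega>) + (\<Sum>j\<le>N. ?s j)"
        using Q_nonneg[of "Suc N" "x (Suc N) \<omega>"] by simp
      finally show "r * (norm (u k \<omega>))\<^sup>2 \<le> x (Suc N) \<omega> \<bullet> (Q (Suc N) *v x (Suc N) \<omega>) + (\<Sum>j\<le>N. ?s j)" .
    qed
    also have "\<dots> < \<infinity>" by fact
    finally have "integrable M (\<lambda>\<omega>. r * (norm (u k \<omega>))\<^sup>2)"
      using r(1) by (intro integrableI_nonneg) auto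
    then show ?thesis using r(1) by (simp add: square_integrable_def)
  qed
  show "square_integrable M (x k)" if "k \<le> N"
    using that
  proof (induction k)
    case 0
    show ?case using x0_square_integrable by (subst square_integrable_cong[OF x_0[OF real]]) auto
  next
    case (Suc k)
    then have k: "k \<le> N" by simp
    have "square_integrable M (\<lambda>\<omega>. A k *v x k \<omega> + B k *v u k \<omega> + w k \<omega>)"
      using Suc k by (intro square_integrable_add square_integrable_mult_vec u w_sq) auto
    then show ?case by (subst square_integrable_cong[OF x_Suc[OF real k]]) auto
  qed
qed

end

text \<open>No finiteness has to be assumed: \<open>xhat\<close> obeys a linear recursion driven by
  the square-integrable error, so \<open>u\<close> and \<open>x\<close> inherit square integrability
  under any trigger, and the control gap reduces pathwise to the form of \<open>\<Gamma> k\<close>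
  in the error.\<close>

lemma cost_certainty_equivalence:
  assumes real: "realization M A B x0 w N x \<delta> u" and ctrl: "control_rule M A B m0 L N x \<delta> u"
  shows "cost M Q R \<theta> N x \<delta> u = ennreal (noise_cost
      + (\<Sum>k\<le>N. (\<integral>\<omega>. err x \<delta> u k \<omega> \<bullet> (\<Gamma> k *v err x \<delta> u k \<omega>) \<partial>M) + (\<integral>\<omega>. (if \<delta> k \<omega> then \<theta> k else 0) \<partial>M)))"
proof -
  let ?xh = "xhat A B m0 x \<delta> u"
  have u_eq: "u k \<omega> = - (L k *v ?xh k \<omega>)" if "k \<le> N" "\<omega> \<in> space M" for k \<omega>
    using ctrl that by (simp add: control_rule_def)
  have u: "square_integrable M (u k)" if "k \<le> N" "square_integrable M (?xh k)" for k
    using square_integrable_minus[OF square_integrable_mult_vec[OF that(2), of "L k"]]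
    by (subst square_integrable_cong[OF u_eq[OF that(1)]]) auto
  have xh: "square_integrable M (?xh k)" if "k \<le> N" for k
    using that
  proof (induction k)
    case 0
    show ?case by (simp add: square_integrable_const)
  next
    case (Suc k)
    then have k: "k \<le> N" and IH: "square_integrable M (?xh k)" by auto
    have "square_integrable M (\<lambda>\<omega>. A k *v ?xh k \<omega> + B k *v u k \<omega> + (if \<delta> k \<omega> then A k *v err x \<delta> u k \<omega> else 0))"
      using k by (intro square_integrable_add square_integrable_mult_vec square_integrable_if IH u
          square_integrable_const err_square_integrable[OF real] \<delta>_measurable[OF real]) auto
    then show ?case unfolding err_def by simp
  qed
  have "x k = (\<lambda>\<omega>. ?xh k \<omega> + err x \<delta> u k \<omega>)" for k by (simp add: err_def)
  then have x: "square_integrable M (x k)" if "k \<le> N" for k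
    using square_integrable_add[OF xh[OF that] err_square_integrable[OF real, of k]] that by simp
  have "(\<integral>\<omega>. control_gap x u k \<omega> \<partial>M) = (\<integral>\<omega>. err x \<delta> u k \<omega> \<bullet> (\<Gamma> k *v err x \<delta> u k \<omega>) \<partial>M)" if k: "k \<le> N" for k
  proof (rule Bochner_Integration.integral_cong[OF refl])
    fix \<omega> assume "\<omega> \<in> space M"
    then have "u k \<omega> + L k *v x k \<omega> = L k *v err x \<delta> u k \<omega>"
      by (simp add: u_eq[OF k] err_def matrix_vector_mult_diff_distrib)
    then show "control_gap x u k \<omega> = err x \<delta> u k \<omega> \<bullet> (\<Gamma> k *v err x \<delta> u k \<omega>)"
      by (simp only: control_gap_def inner_\<Gamma>[OF k])
  qed
  then show ?thesis
    using cost_eq[OF real x u[OF _ xh]] by simp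
qed

text \<open>An index shift matches the error weights with \<open>trigger_cost\<close>: the term at
  time 0 depends only on \<open>x0\<close>, and the one at \<open>Suc N\<close> vanishes because
  \<open>\<Gamma> (Suc N) = 0\<close>.\<close>

lemma cost_control_rule:
  assumes real: "realization M A B x0 w N x \<delta> u" and ctrl: "control_rule M A B m0 L N x \<delta> u"
  shows "cost M Q R \<theta> N x \<delta> u = ennreal (noise_cost + (\<integral>\<omega>. (x0 \<omega> - m0) \<bullet> (\<Gamma> 0 *v (x0 \<omega> - m0)) \<partial>M)
      + (\<Sum>k\<in>{0..N}. \<integral>\<omega>. trigger_cost x \<delta> u k \<omega> \<partial>M))"
proof -
  define q where "q k = (\<integral>\<omega>. err x \<delta> u k \<omega> \<bullet> (\<Gamma> k *v err x \<delta> u k \<omega>) \<partial>M)" for k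
  define h where "h k = (\<integral>\<omega>. (if \<delta> k \<omega> then \<theta> k else 0) \<partial>M)" for k
  have "(\<integral>\<omega>. trigger_cost x \<delta> u k \<omega> \<partial>M) = h k + q (Suc k)" if "k \<le> N" for k
    unfolding trigger_cost_def h_def q_def using that
    by (intro Bochner_Integration.integral_add threshold_integrable[OF real] integrable_quadratic_form
        err_square_integrable[OF real]) auto
  then have "(\<Sum>k\<in>{0..N}. \<integral>\<omega>. trigger_cost x \<delta> u k \<omega> \<partial>M) = (\<Sum>k\<le>N. h k) + (\<Sum>k\<le>N. q (Suc k))"
    by (simp add: atMost_atLeast0 sum.distrib[symmetric])
  moreover have "(\<Sum>k\<le>N. q k) = q 0 + (\<Sum>k\<le>N. q (Suc k))"
    using sum.atMost_Suc_shift[of q N] by (simp add: q_def Gamma_final)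
  moreover have "q 0 = (\<integral>\<omega>. (x0 \<omega> - m0) \<bullet> (\<Gamma> 0 *v (x0 \<omega> - m0)) \<partial>M)"
    unfolding q_def by (rule Bochner_Integration.integral_cong) (simp_all add: err_0[OF real])
  ultimately show ?thesis
    unfolding cost_certainty_equivalence[OF assms] q_def[symmetric] h_def[symmetric]
    by (simp add: sum.distrib algebra_simps)
qed

text \<open>Both closed loops start from the same error \<open>x0 - m0\<close>, so the expectation
  of \<open>V 0\<close> there is a common benchmark: attained by the VoI rule, a lower bound for the
  competitor.\<close>

lemma trigger_policy_optimal:
  assumes "realization M A B x0 w N x \<delta> u" "trigger_rule M A B m0 w \<Gamma> \<theta> N x \<delta> u"
    "control_rule M A B m0 L N x \<delta> u"
    and "realization M A B x0 w N x' \<delta>' u'" "control_rule M A B m0 L N x' \<delta>' u'"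
  shows "cost M Q R \<theta> N x \<delta> u \<le> cost M Q R \<theta> N x' \<delta>' u'"
proof -
  have "(\<Sum>k\<in>{0..N}. \<integral>\<omega>. trigger_cost x \<delta> u k \<omega> \<partial>M) = (\<integral>\<omega>. V 0 (err x \<delta> u 0 \<omega>) \<partial>M)"
    by (rule V_eq_trigger_cost[OF assms(1,2), symmetric]) simp
  also have "\<dots> = (\<integral>\<omega>. V 0 (err x' \<delta>' u' 0 \<omega>) \<partial>M)"
    by (rule Bochner_Integration.integral_cong) (simp_all add: err_0[OF assms(1)] err_0[OF assms(4)])
  also have "\<dots> \<le> (\<Sum>k\<in>{0..N}. \<integral>\<omega>. trigger_cost x' \<delta>' u' k \<omega> \<partial>M)"
    by (rule V_le_trigger_cost[OF assms(4)]) simp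
  finally show ?thesis
    unfolding cost_control_rule[OF assms(1,3)] cost_control_rule[OF assms(4,5)]
    by (intro ennreal_leI add_left_mono)
qed

text \<open>Error and VoI decision form a loop driven only by \<open>x0\<close> and the noise, so
  two realizations agree pathwise. A deviating controller thus leaves the communication cost
  unchanged.\<close>

lemma trigger_rule_determines_err:
  assumes "realization M A B x0 w N x \<delta> u" "trigger_rule M A B m0 w \<Gamma> \<theta> N x \<delta> u"
    and "realization M A B x0 w N x' \<delta>' u'" "trigger_rule M A B m0 w \<Gamma> \<theta> N x' \<delta>' u'"
    and "k \<le> N" "\<omega> \<in> space M"
  shows "err x \<delta> u k \<omega> = err x' \<delta>' u' k \<omega> \<and> \<delta> k \<omega> = \<delta>' k \<omega>"
  using assms(5)
proof (induction k)
  case 0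
  then show ?case
    using \<delta>_eq_voi[OF assms(1,2) _ assms(6)] \<delta>_eq_voi[OF assms(3,4) _ assms(6)] assms(6)
    by (simp add: err_0[OF assms(1)] err_0[OF assms(3)])
next
  case (Suc k)
  then have "err x \<delta> u (Suc k) \<omega> = err x' \<delta>' u' (Suc k) \<omega>"
    using assms(6) by (simp add: err_Suc[OF assms(1)] err_Suc[OF assms(3)])
  then show ?case
    using \<delta>_eq_voi[OF assms(1,2) Suc.prems assms(6)] \<delta>_eq_voi[OF assms(3,4) Suc.prems assms(6)] by simp
qed

text \<open>A competitor of infinite cost is no threat. One of finite cost is square integrable, so
  its cost splits and can be compared time by time along the common errors and decisions.\<close>

lemma control_policy_optimal:
  assumes r: "realization M A B x0 w N x \<delta> u" "trigger_rule M A B m0 w \<Gamma> \<theta> N x \<delta> u"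
    and c: "control_rule M A B m0 L N x \<delta> u"
    and r': "realization M A B x0 w N x' \<delta>' u'" "trigger_rule M A B m0 w \<Gamma> \<theta> N x' \<delta>' u'"
  shows "cost M Q R \<theta> N x \<delta> u \<le> cost M Q R \<theta> N x' \<delta>' u'"
proof (cases "cost M Q R \<theta> N x' \<delta>' u' < \<infinity>")
  case True
  note sq = square_integrable_of_finite_cost[OF r' True]
  have "(\<integral>\<omega>. err x \<delta> u k \<omega> \<bullet> (\<Gamma> k *v err x \<delta> u k \<omega>) \<partial>M) + (\<integral>\<omega>. (if \<delta> k \<omega> then \<theta> k else 0) \<partial>M)
      \<le> (\<integral>\<omega>. control_gap x' u' k \<omega> \<partial>M) + (\<integral>\<omega>. (if \<delta>' k \<omega> then \<theta> k else 0) \<partial>M)" if k: "k \<le> N" for k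
  proof (rule add_mono)
    note same = trigger_rule_determines_err[OF r r' k]
    have "(\<integral>\<omega>. err x \<delta> u k \<omega> \<bullet> (\<Gamma> k *v err x \<delta> u k \<omega>) \<partial>M)
        = (\<integral>\<omega>. err x' \<delta>' u' k \<omega> \<bullet> (\<Gamma> k *v err x' \<delta>' u' k \<omega>) \<partial>M)"
      by (rule Bochner_Integration.integral_cong) (simp_all add: same)
    also have "\<dots> \<le> (\<integral>\<omega>. control_gap x' u' k \<omega> \<partial>M)"
      by (rule control_gap_ge[OF r' k sq(2,1)[OF k]])
    finally show "(\<integral>\<omega>. err x \<delta> u k \<omega> \<bullet> (\<Gamma> k *v err x \<delta> u k \<omega>) \<partial>M) \<le> (\<integral>\<omega>. control_gap x' u' k \<omega> \<partial>M)" .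
    show "(\<integral>\<omega>. (if \<delta> k \<omega> then \<theta> k else 0) \<partial>M) \<le> (\<integral>\<omega>. (if \<delta>' k \<omega> then \<theta> k else 0) \<partial>M)"
      by (rule eq_refl, rule Bochner_Integration.integral_cong) (simp_all add: same)
  qed
  moreover have "cost M Q R \<theta> N x' \<delta>' u' = ennreal (noise_cost
      + (\<Sum>k\<le>N. (\<integral>\<omega>. control_gap x' u' k \<omega> \<partial>M) + (\<integral>\<omega>. (if \<delta>' k \<omega> then \<theta> k else 0) \<partial>M)))"
    by (rule cost_eq[OF r'(1)]) (auto intro: sq)
  ultimately show ?thesis
    unfolding cost_certainty_equivalence[OF r(1) c]
    by (auto intro!: ennreal_leI add_left_mono sum_mono)
next
  case False
  then have "cost M Q R \<theta> N x' \<delta>' u' = \<infinity>" by (simp add: less_top[symmetric])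
  then show ?thesis by simp
qed

text \<open>The equilibrium loop is run in the coordinates estimate and error, in which both
  policies are explicit; the state is recovered as their sum. This avoids the circular dependence
  among \<open>x\<close>, \<open>\<delta>\<close>, \<open>u\<close> and \<open>xhat\<close>.\<close>

primrec loop :: "nat \<Rightarrow> 'a \<Rightarrow> (real^'n) \<times> (real^'n)" where
  "loop 0 \<omega> = (m0, x0 \<omega> - m0)"
| "loop (Suc k) \<omega> = (let xh = fst (loop k \<omega>); e = snd (loop k \<omega>); d = (0 \<le> voi k e) in
     (A k *v xh - B k *v (L k *v xh) + (if d then A k *v e else 0), (if d then 0 else A k *v e) + w k \<omega>))"

text \<open>The optimality statements quantify over realizations of the profile; this existence
  statement ensures that they are not vacuous.\<close>

lemma equilibrium_realizable:
  "\<exists>x \<delta> u. realization M A B x0 w N x \<delta> u \<and> trigger_rule M A B m0 w \<Gamma> \<theta> N x \<delta> u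
     \<and> control_rule M A B m0 L N x \<delta> u"
proof -
  define x where "x k \<omega> = fst (loop k \<omega>) + snd (loop k \<omega>)" for k \<omega>
  define \<delta> where "\<delta> k \<omega> \<longleftrightarrow> 0 \<le> voi k (snd (loop k \<omega>))" for k \<omega>
  define u where "u k \<omega> = - (L k *v fst (loop k \<omega>))" for k \<omega>
  have xh: "xhat A B m0 x \<delta> u k = (\<lambda>\<omega>. fst (loop k \<omega>))" for k
  proof (induction k)
    case (Suc k)
    then show ?case by (auto simp: Let_def x_def \<delta>_def u_def)
  qed simp
  have e: "snd (loop k \<omega>) = x k \<omega> - xhat A B m0 x \<delta> u k \<omega>" for k \<omega>
    by (simp add: xh x_def)
  have u_eq: "u k = (\<lambda>\<omega>. - (L k *v xhat A B m0 x \<delta> u k \<omega>))" for k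
    by (rule ext) (simp add: u_def xh)
  have \<delta>_eq: "\<delta> k = (\<lambda>\<omega>. 0 \<le> voi k (x k \<omega> - xhat A B m0 x \<delta> u k \<omega>))" for k
    by (rule ext) (simp only: \<delta>_def e)
  \<comment> \<open>Measurability of \<open>xhat\<close> at the same time stays a premise here,
    because it is proved by an induction whose step needs the preceding decision.\<close>
  have \<delta>_meas: "\<delta> k \<in> measurable (info_e M x k) (count_space UNIV)"
    if "k \<le> N" "xhat A B m0 x \<delta> u k \<in> borel_measurable (info_e M x k)" for k
  proof -
    note [measurable] = that(2) x_info_e[OF order_refl, of x k M] voi_measurable[OF that(1)]
    show ?thesis by (subst \<delta>_eq) measurable
  qed
  have xh_e: "xhat A B m0 x \<delta> u k \<in> borel_measurable (info_e M x k)" if "k \<le> N" for k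
    using that
  proof (induction k)
    case (Suc k)
    then have IH: "xhat A B m0 x \<delta> u k \<in> borel_measurable (info_e M x k)" and k: "k \<le> N" by auto
    note sub = measurable_from_subalg[OF info_e_mono[of k "Suc k" M x]]
    note [measurable] = sub[OF _ IH, simplified] sub[OF _ \<delta>_meas[OF k IH], simplified] x_info_e[of k "Suc k" x M]
    have [measurable]: "u k \<in> borel_measurable (info_e M x (Suc k))" by (subst u_eq) measurable
    show ?case by simp
  qed simp
  have xh_c: "xhat A B m0 x \<delta> u k \<in> borel_measurable (info_c M x \<delta> k)" for k
  proof (induction k)
    case (Suc k)
    note [measurable] = Suc
    have "u k \<in> borel_measurable (info_c M x \<delta> k)" by (subst u_eq) measurable
    then show ?case by (rule xhat_Suc_info_c[OF Suc])
  qed simp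
  have "x (Suc k) \<omega> = A k *v x k \<omega> + B k *v u k \<omega> + w k \<omega>" for k \<omega>
    by (simp add: x_def u_def Let_def matrix_vector_right_distrib)
  moreover have "u k \<in> borel_measurable (info_c M x \<delta> k)" for k
    using xh_c[of k] by (subst u_eq) measurable
  ultimately have "realization M A B x0 w N x \<delta> u"
    using \<delta>_meas[OF _ xh_e] by (simp add: realization_def x_def)
  moreover have "trigger_rule M A B m0 w \<Gamma> \<theta> N x \<delta> u"
    by (simp add: trigger_rule_def \<delta>_def e)
  moreover have "control_rule M A B m0 L N x \<delta> u"
    by (simp add: control_rule_def u_def xh)
  ultimately show ?thesis by blast
qed

end

theorem theorem2:
  fixes M :: "'a measure"
    and A :: "nat \<Rightarrow> real^'n^'n" and B :: "nat \<Rightarrow> real^'m^'n"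
    and Q :: "nat \<Rightarrow> real^'n^'n" and R :: "nat \<Rightarrow> real^'m^'m"
    and W :: "nat \<Rightarrow> real^'n^'n" and m0 :: "real^'n" and M0 :: "real^'n^'n"
    and x0 :: "'a \<Rightarrow> real^'n" and w :: "nat \<Rightarrow> 'a \<Rightarrow> real^'n"
    and ell :: "nat \<Rightarrow> real" and lam :: real and \<theta> :: "nat \<Rightarrow> real" and N :: nat
    and S :: "nat \<Rightarrow> real^'n^'n" and \<Gamma> :: "nat \<Rightarrow> real^'n^'n" and L :: "nat \<Rightarrow> real^'n^'m"
  assumes P: "prob_space M"
    and x0_gauss: "gaussian_rv M x0 m0 M0" and M0_psd: "psd M0"
    and w_gauss: "\<forall>k\<le>N. gaussian_rv M (w k) 0 (W k) \<and> pd (W k)"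
    and indep: "prob_space.indep_vars M (\<lambda>_. borel) (\<lambda>i. case i of None \<Rightarrow> x0 | Some k \<Rightarrow> w k)
                   (insert None (Some ` {..N}))"
    and ctrb: "\<forall>k\<le>N. controllable (A k) (B k)"
    and Q_psd: "\<forall>k\<le>Suc N. psd (Q k)" and R_pd: "\<forall>k\<le>N. pd (R k)"
    and theta: "\<forall>k\<le>N. \<theta> k = ell k * lam \<and> 0 \<le> \<theta> k"
    and S_final: "S (Suc N) = Q (Suc N)"
    and Gamma_def: "\<forall>k\<le>N. \<Gamma> k = transpose (A k) ** S (Suc k) ** B k
                     ** matrix_inv (transpose (B k) ** S (Suc k) ** B k + R k)
                     ** transpose (B k) ** S (Suc k) ** A k"
    and S_rec: "\<forall>k\<le>N. S k = Q k + transpose (A k) ** S (Suc k) ** A k - \<Gamma> k"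
    and Gamma_final: "\<Gamma> (Suc N) = 0"
    and L_def: "\<forall>k\<le>N. L k = matrix_inv (transpose (B k) ** S (Suc k) ** B k + R k)
                     ** transpose (B k) ** S (Suc k) ** A k"
  shows
    \<comment> \<open>the profile (\<pi>*,\<mu>*) is realizable by admissible policies\<close>
    "(\<exists>x \<delta> u. realization M A B x0 w N x \<delta> u
        \<and> trigger_rule M A B m0 w \<Gamma> \<theta> N x \<delta> u \<and> control_rule M A B m0 L N x \<delta> u)
     \<comment> \<open>no admissible triggering policy does better against \<mu>*\<close>
     \<and> (\<forall>x \<delta> u x' \<delta>' u'.
          realization M A B x0 w N x \<delta> u \<and> trigger_rule M A B m0 w \<Gamma> \<theta> N x \<delta> u
          \<and> control_rule M A B m0 L N x \<delta> u
          \<and> realization M A B x0 w N x' \<delta>' u' \<and> control_rule M A B m0 L N x' \<delta>' u'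
          \<longrightarrow> cost M Q R \<theta> N x \<delta> u \<le> cost M Q R \<theta> N x' \<delta>' u')
     \<comment> \<open>no admissible control policy does better against \<pi>*\<close>
     \<and> (\<forall>x \<delta> u x' \<delta>' u'.
          realization M A B x0 w N x \<delta> u \<and> trigger_rule M A B m0 w \<Gamma> \<theta> N x \<delta> u
          \<and> control_rule M A B m0 L N x \<delta> u
          \<and> realization M A B x0 w N x' \<delta>' u' \<and> trigger_rule M A B m0 w \<Gamma> \<theta> N x' \<delta>' u'
          \<longrightarrow> cost M Q R \<theta> N x \<delta> u \<le> cost M Q R \<theta> N x' \<delta>' u')
     \<comment> \<open>symmetric threshold: VoI_k is an even function of e_k\<close>
     \<and> (\<forall>k\<le>N. \<forall>e. VoI M w A \<Gamma> \<theta> N k (- e) = VoI M w A \<Gamma> \<theta> N k e)"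
proof -
  interpret prob_space M by (rule P)
  have meas: "X \<in> borel_measurable M" if "gaussian_rv M X m C" for X :: "'a \<Rightarrow> real^'n" and m C
    using that by (simp add: gaussian_rv_def)
  have sq: "square_integrable M (\<lambda>\<omega>. X \<omega> - m)" if "gaussian_rv M X m C" for X :: "'a \<Rightarrow> real^'n" and m C
    using gaussian_rv_integrable_norm_square[OF P that] meas[OF that] by (simp add: square_integrable_def)
  have w: "square_integrable M (w k)" "distr M borel (w k) = distr M borel (\<lambda>\<omega>. - w k \<omega>)" if "k \<le> N" for k
    using sq[of "w k" 0 "W k"] gaussian_rv_symmetric[OF P, of "w k" 0 "W k"] w_gauss that by auto
  interpret event_trigger_model M A B Q R N S \<Gamma> L m0 x0 w \<theta>
    using sq[OF x0_gauss] gaussian_rv_symmetric[OF P x0_gauss] w indep Q_psd R_pd theta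
      S_final Gamma_def S_rec Gamma_final L_def
    by unfold_locales auto
  show ?thesis
    using equilibrium_realizable trigger_policy_optimal control_policy_optimal voi_uminus
    by (intro conjI) blast+
qed

end
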